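(* Let $N$ be an $A$-definable normal subgroup of $G$. If $H^1_{\mathrm{def}}(\mathcal G,G/N)$ is finite and $H^1_{\mathrm{def}}(\mathcal G,N_\mu)$ is finite for all $\mu\in H^1_{\mathrm{def}}(\mathcal G,G)$, then $H^1_{\mathrm{def}}(\mathcal G,G)$ is finite as well.
   Context: Setting. Fix a first-order structure $M$ and a subset $A$ of $M$ such that: (i) $M$ is atomic over $A$, i.e. for every finite tuple $a$ from $M$ the type $\mathrm{tp}(a/A)$ is isolated; (ii) for all finite tuples $a,b$ from $M$ with $\mathrm{tp}(a/A)=\mathrm{tp}(b/A)$ there is $\sigma\in\mathrm{Aut}(M/A)$ with $\sigma(a)=b$; (iii) the theory of $M$ eliminates imaginaries (so $G/N$ is identified with an $A$-definable group). Put $\mathcal G=\mathrm{Aut}(M/A)$. $G$ is an arbitrary group definable in $M$ with parameters from $A$; $\mathcal G$ acts on $G$ by group automorphisms. "Definable" means definable in $M$ with parameters from $M$; "$A$-definable" means definable with parameters from $A$. Tuples are finite. Definable cohomology. For an $A$-definable group $G$, a definable cocycle from $\mathcal G$ to $G$ is a map $\Phi:\mathcal G\to G$ with $\Phi(\sigma_1\sigma_2)=\Phi(\sigma_1)\cdot\sigma_1(\Phi(\sigma_2))$ for which there are a tuple $a$ from $M$ and an $A$-definable (partial) function $h(x,y)$ with $\Phi(\sigma)=h(a,\sigma(a))$ for all $\sigma\in\mathcal G$. $\Phi$ and $\Psi$ are cohomologous if there is $b\in G$ with $\Psi(\sigma)=b^{-1}\Phi(\sigma)\sigma(b)$ for all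 $\sigma$. $H^1_{\mathrm{def}}(\mathcal G,G)$ is the set of equivalence classes of definable cocycles. The $A$-form $N_\mu$. $\mathrm{Aut}_{\mathrm{def}}(N)$ is the group of $M$-definable group automorphisms of $N$, on which $\sigma\in\mathcal G$ acts by applying $\sigma$ to graphs (similarly $\sigma(g)$ is defined for any definable map $g$). A definable cocycle from $\mathcal G$ to $\mathrm{Aut}_{\mathrm{def}}(N)$ is a map $\Lambda$ with $\Lambda(\sigma_1\sigma_2)=\Lambda(\sigma_1)\cdot\sigma_1(\Lambda(\sigma_2))$ and $\Lambda(\sigma)(-)=h(a,\sigma(a),-)$ for some tuple $a$ and $A$-definable $h$. $\Lambda,\Lambda'$ are cohomologous if $\Lambda'(\sigma)=\phi^{-1}\Lambda(\sigma)\sigma(\phi)$ for some $\phi\in\mathrm{Aut}_{\mathrm{def}}(N)$ and all $\sigma$. $H^1_{\mathrm{def}}(\mathcal G,\mathrm{Aut}_{\mathrm{def}}(N))$ is the set of classes. An $A$-form of $N$ is an $A$-definable group $H$ admitting an $M$-definable group isomorphism $g:N\to H$. The map $H\mapsto[\sigma\mapsto g^{-1}\circ\sigma(g)]$ is a bijection between $A$-forms of $N$ up to $A$-definable isomorphism and $H^1_{\mathrm{def}}(\mathcal G,\mathrm{Aut}_{\mathrm{def}}(N))$. For $\mu\in H^1_{\mathrm{def}}(\mathcal G,G)$ and a definable cocycle $\Phi$ of class $\mu$, the map $\Lambda_\Phi(\sigma)(n)=\Phi(\sigma)\,n\,\Phi(\sigma)^{-1}$ is a definable cocycle from $\mathcal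 G$ to $\mathrm{Aut}_{\mathrm{def}}(N)$ whose class depends only on $\mu$. $N_\mu$ is the $A$-form of $N$ (unique up to $A$-definable isomorphism) corresponding to this class. *)

theory Defs
  imports "HOL-Algebra.Coset" "HOL-Algebra.Bij"
begin

section \<open>First-order structures, formulas with parameters, satisfaction\<close>

text \<open>The universe of a structure is the type \<open>'a\<close>. The signature consists of the function
  symbols \<open>funs M\<close> and relation symbols \<open>rels M\<close> with their arities; an interpretation is only
  ever used at lists of the right length.\<close>

record ('f, 'r, 'a) fo_structure =
  funs :: "'f set"
  rels :: "'r set"
  farity :: "'f \<Rightarrow> nat"
  rarity :: "'r \<Rightarrow> nat"
  fint :: "'f \<Rightarrow> 'a list \<Rightarrow> 'a"
  rint :: "'r \<Rightarrow> 'a list \<Rightarrow> bool"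

datatype ('f, 'a) fo_term = Var nat | Par 'a | Fn 'f "('f, 'a) fo_term list"

text \<open>Variables are de Bruijn indices: \<open>FEx\<close> binds index \<open>0\<close> and shifts the others.\<close>

datatype ('f, 'r, 'a) fo_formula =
    FRel 'r "('f, 'a) fo_term list"
  | FEq "('f, 'a) fo_term" "('f, 'a) fo_term"
  | FNeg "('f, 'r, 'a) fo_formula"
  | FAnd "('f, 'r, 'a) fo_formula" "('f, 'r, 'a) fo_formula"
  | FEx "('f, 'r, 'a) fo_formula"

fun is_term :: "('f, 'r, 'a) fo_structure \<Rightarrow> 'a set \<Rightarrow> nat \<Rightarrow> ('f, 'a) fo_term \<Rightarrow> bool" where
  "is_term M B n (Var i) \<longleftrightarrow> i < n"
| "is_term M B n (Par c) \<longleftrightarrow> c \<in> B"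
| "is_term M B n (Fn f ts) \<longleftrightarrow>
     f \<in> funs M \<and> length ts = farity M f \<and> (\<forall>t \<in> set ts. is_term M B n t)"

text \<open>\<open>is_formula M B n \<phi>\<close>: a formula in the language of \<open>M\<close> with parameters
  from \<open>B\<close> whose free variables are among the first \<open>n\<close>.\<close>

fun is_formula ::
  "('f, 'r, 'a) fo_structure \<Rightarrow> 'a set \<Rightarrow> nat \<Rightarrow> ('f, 'r, 'a) fo_formula \<Rightarrow> bool" where
  "is_formula M B n (FRel r ts) \<longleftrightarrow>
     r \<in> rels M \<and> length ts = rarity M r \<and> (\<forall>t \<in> set ts. is_term M B n t)"
| "is_formula M B n (FEq t u) \<longleftrightarrow> is_term M B n t \<and> is_term M B n u"
| "is_formula M B n (FNeg p) \<longleftrightarrow> is_formula M B n p"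
| "is_formula M B n (FAnd p q) \<longleftrightarrow> is_formula M B n p \<and> is_formula M B n q"
| "is_formula M B n (FEx p) \<longleftrightarrow> is_formula M B (Suc n) p"

fun eval :: "('f, 'r, 'a) fo_structure \<Rightarrow> (nat \<Rightarrow> 'a) \<Rightarrow> ('f, 'a) fo_term \<Rightarrow> 'a" where
  "eval M s (Var i) = s i"
| "eval M s (Par c) = c"
| "eval M s (Fn f ts) = fint M f (map (eval M s) ts)"

fun sat :: "('f, 'r, 'a) fo_structure \<Rightarrow> (nat \<Rightarrow> 'a) \<Rightarrow> ('f, 'r, 'a) fo_formula \<Rightarrow> bool" where
  "sat M s (FRel r ts) \<longleftrightarrow> rint M r (map (eval M s) ts)"
| "sat M s (FEq t u) \<longleftrightarrow> eval M s t = eval M s u"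
| "sat M s (FNeg p) \<longleftrightarrow> \<not> sat M s p"
| "sat M s (FAnd p q) \<longleftrightarrow> sat M s p \<and> sat M s q"
| "sat M s (FEx p) \<longleftrightarrow> (\<exists>x. sat M (case_nat x s) p)"


section \<open>Types, automorphisms, definable sets and maps\<close>

definition tuples :: "nat \<Rightarrow> 'a list set" where
  "tuples n = {x. length x = n}"

definition tp ::
  "('f, 'r, 'a) fo_structure \<Rightarrow> 'a set \<Rightarrow> 'a list \<Rightarrow> ('f, 'r, 'a) fo_formula set" where
  "tp M A a = {\<phi>. is_formula M A (length a) \<phi> \<and> sat M (nth a) \<phi>}"

definition isolated_type ::
  "('f, 'r, 'a) fo_structure \<Rightarrow> nat \<Rightarrow> ('f, 'r, 'a) fo_formula set \<Rightarrow> bool" where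
  "isolated_type M n p \<longleftrightarrow>
     (\<exists>\<phi> \<in> p. \<forall>\<psi> \<in> p. \<forall>x \<in> tuples n. sat M (nth x) \<phi> \<longrightarrow> sat M (nth x) \<psi>)"

definition atomic_over :: "('f, 'r, 'a) fo_structure \<Rightarrow> 'a set \<Rightarrow> bool" where
  "atomic_over M A \<longleftrightarrow> (\<forall>a. isolated_type M (length a) (tp M A a))"

definition aut_over :: "('f, 'r, 'a) fo_structure \<Rightarrow> 'a set \<Rightarrow> ('a \<Rightarrow> 'a) set" where
  "aut_over M A = {\<sigma>. bij \<sigma>
     \<and> (\<forall>f \<in> funs M. \<forall>x \<in> tuples (farity M f). fint M f (map \<sigma> x) = \<sigma> (fint M f x))
     \<and> (\<forall>r \<in> rels M. \<forall>x \<in> tuples (rarity M r). rint M r (map \<sigma> x) \<longleftrightarrow> rint M r x)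
     \<and> (\<forall>a \<in> A. \<sigma> a = a)}"

definition homogeneous_over :: "('f, 'r, 'a) fo_structure \<Rightarrow> 'a set \<Rightarrow> bool" where
  "homogeneous_over M A \<longleftrightarrow>
     (\<forall>a b. length a = length b \<and> tp M A a = tp M A b \<longrightarrow> (\<exists>\<sigma> \<in> aut_over M A. map \<sigma> a = b))"

definition definable :: "('f, 'r, 'a) fo_structure \<Rightarrow> 'a set \<Rightarrow> 'a list set \<Rightarrow> bool" where
  "definable M B X \<longleftrightarrow>
     (\<exists>n \<phi>. is_formula M B n \<phi> \<and> X = {x \<in> tuples n. sat M (nth x) \<phi>})"

text \<open>Partial functions from some \<open>M\<^sup>m\<close> to some \<open>M\<^sup>n\<close> with definable graph; the graph is a set of
  concatenated tuples, which is unambiguous because \<open>m\<close> and \<open>n\<close> are fixed.\<close>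

definition definable_pmap ::
  "('f, 'r, 'a) fo_structure \<Rightarrow> 'a set \<Rightarrow> ('a list \<rightharpoonup> 'a list) \<Rightarrow> bool" where
  "definable_pmap M B h \<longleftrightarrow>
     (\<exists>m. dom h \<subseteq> tuples m) \<and> (\<exists>n. ran h \<subseteq> tuples n)
     \<and> definable M B {x @ y | x y. h x = Some y}"

definition definable_map ::
  "('f, 'r, 'a) fo_structure \<Rightarrow> 'a set \<Rightarrow> 'a list set \<Rightarrow> ('a list \<Rightarrow> 'a list) \<Rightarrow> bool" where
  "definable_map M B X f \<longleftrightarrow> definable_pmap M B ((Some \<circ> f) |` X)"

text \<open>Elimination of imaginaries in its uniform form: every quotient of \<open>M\<^sup>n\<close> by a
  \<open>\<emptyset>\<close>-definable equivalence relation is \<open>\<emptyset>\<close>-definably identified with a subset of some \<open>M\<^sup>m\<close>.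
  For given defining formulas, both the hypothesis on \<open>E\<close> and the conclusion are expressed by
  sentences, so this is a property of the theory of \<open>M\<close>.\<close>

definition eliminates_imaginaries :: "('f, 'r, 'a) fo_structure \<Rightarrow> bool" where
  "eliminates_imaginaries M \<longleftrightarrow>
     (\<forall>n E. equiv (tuples n) E \<and> definable M {} {x @ y | x y. (x, y) \<in> E} \<longrightarrow>
       (\<exists>f. definable_map M {} (tuples n) f
          \<and> (\<forall>x \<in> tuples n. \<forall>y \<in> tuples n. (x, y) \<in> E \<longleftrightarrow> f x = f y)))"


section \<open>Definable groups\<close>

definition definable_group ::
  "('f, 'r, 'a) fo_structure \<Rightarrow> 'a set \<Rightarrow> 'a list monoid \<Rightarrow> bool" where
  "definable_group M B G \<longleftrightarrow> group G \<and> definable M B (carrier G)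
     \<and> definable M B {x @ y @ (x \<otimes>\<^bsub>G\<^esub> y) | x y. x \<in> carrier G \<and> y \<in> carrier G}"

text \<open>Identification of the interpretable group \<open>G/N\<close> with a \<open>B\<close>-definable group \<open>Q\<close>.\<close>

definition quotient_identification ::
  "('f, 'r, 'a) fo_structure \<Rightarrow> 'a set \<Rightarrow> 'a list monoid \<Rightarrow> 'a list set \<Rightarrow>
   'a list monoid \<Rightarrow> ('a list set \<Rightarrow> 'a list) \<Rightarrow> bool" where
  "quotient_identification M B G N Q \<iota> \<longleftrightarrow> definable_group M B Q \<and> \<iota> \<in> iso (G Mod N) Q
     \<and> definable_map M B (carrier G) (\<lambda>g. \<iota> (N #>\<^bsub>G\<^esub> g))"

definition definable_iso ::
  "('f, 'r, 'a) fo_structure \<Rightarrow> 'a set \<Rightarrow> 'a list monoid \<Rightarrow> 'a list monoid \<Rightarrow>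
   ('a list \<Rightarrow> 'a list) set" where
  "definable_iso M B G H = {g \<in> iso G H. definable_map M B (carrier G) g}"

text \<open>\<open>UNIV\<close> as parameter set: definable with arbitrary parameters from \<open>M\<close>.\<close>

definition Aut_def ::
  "('f, 'r, 'a) fo_structure \<Rightarrow> 'a list monoid \<Rightarrow> ('a list \<Rightarrow> 'a list) monoid" where
  "Aut_def M K = (AutoGroup K)
     \<lparr>carrier := {f \<in> auto K. definable_map M UNIV (carrier K) f}\<rparr>"

text \<open>The map whose graph is the image under \<open>\<sigma>\<close> of the graph of \<open>g\<close>, for \<open>g\<close> defined on
  a \<open>\<sigma>\<close>-invariant set \<open>X\<close>.\<close>

definition act_map ::
  "'a list set \<Rightarrow> ('a \<Rightarrow> 'a) \<Rightarrow> ('a list \<Rightarrow> 'a list) \<Rightarrow> 'a list \<Rightarrow> 'a list" where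
  "act_map X \<sigma> g = (\<lambda>x \<in> X. map \<sigma> (g (map (inv_into UNIV \<sigma>) x)))"


section \<open>Definable cohomology\<close>

text \<open>Cocycles from a set \<open>S\<close> of permutations to a group \<open>C\<close> on which \<open>S\<close> acts through \<open>act\<close>.\<close>

definition cocycles ::
  "('a \<Rightarrow> 'a) set \<Rightarrow> ('c, 'm) monoid_scheme \<Rightarrow> (('a \<Rightarrow> 'a) \<Rightarrow> 'c \<Rightarrow> 'c) \<Rightarrow> (('a \<Rightarrow> 'a) \<Rightarrow> 'c) set" where
  "cocycles S C act = {\<Phi> \<in> S \<rightarrow>\<^sub>E carrier C.
     \<forall>\<sigma> \<in> S. \<forall>\<tau> \<in> S. \<Phi> (\<sigma> \<circ> \<tau>) = \<Phi> \<sigma> \<otimes>\<^bsub>C\<^esub> act \<sigma> (\<Phi> \<tau>)}"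

definition cohomologous ::
  "('a \<Rightarrow> 'a) set \<Rightarrow> ('c, 'm) monoid_scheme \<Rightarrow> (('a \<Rightarrow> 'a) \<Rightarrow> 'c \<Rightarrow> 'c) \<Rightarrow>
   (('a \<Rightarrow> 'a) \<Rightarrow> 'c) \<Rightarrow> (('a \<Rightarrow> 'a) \<Rightarrow> 'c) \<Rightarrow> bool" where
  "cohomologous S C act \<Phi> \<Psi> \<longleftrightarrow>
     (\<exists>b \<in> carrier C. \<forall>\<sigma> \<in> S. \<Psi> \<sigma> = inv\<^bsub>C\<^esub> b \<otimes>\<^bsub>C\<^esub> \<Phi> \<sigma> \<otimes>\<^bsub>C\<^esub> act \<sigma> b)"

definition Z1_def ::
  "('f, 'r, 'a) fo_structure \<Rightarrow> 'a set \<Rightarrow> 'a list monoid \<Rightarrow> (('a \<Rightarrow> 'a) \<Rightarrow> 'a list) set" where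
  "Z1_def M A G = {\<Phi> \<in> cocycles (aut_over M A) G map.
     \<exists>a h. definable_pmap M A h \<and> (\<forall>\<sigma> \<in> aut_over M A. h (a @ map \<sigma> a) = Some (\<Phi> \<sigma>))}"

definition H1_def ::
  "('f, 'r, 'a) fo_structure \<Rightarrow> 'a set \<Rightarrow> 'a list monoid \<Rightarrow> (('a \<Rightarrow> 'a) \<Rightarrow> 'a list) set set" where
  "H1_def M A G = Z1_def M A G //
     {(\<Phi>, \<Psi>). \<Phi> \<in> Z1_def M A G \<and> \<Psi> \<in> Z1_def M A G \<and> cohomologous (aut_over M A) G map \<Phi> \<Psi>}"

definition Z1_Aut_def ::
  "('f, 'r, 'a) fo_structure \<Rightarrow> 'a set \<Rightarrow> 'a list monoid \<Rightarrow>
   (('a \<Rightarrow> 'a) \<Rightarrow> 'a list \<Rightarrow> 'a list) set" where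
  "Z1_Aut_def M A K = {\<Lambda> \<in> cocycles (aut_over M A) (Aut_def M K) (act_map (carrier K)).
     \<exists>a h. definable_pmap M A h
       \<and> (\<forall>\<sigma> \<in> aut_over M A. \<forall>x \<in> carrier K. h (a @ map \<sigma> a @ x) = Some (\<Lambda> \<sigma> x))}"

definition cohom_Aut_rel ::
  "('f, 'r, 'a) fo_structure \<Rightarrow> 'a set \<Rightarrow> 'a list monoid \<Rightarrow>
   ((('a \<Rightarrow> 'a) \<Rightarrow> 'a list \<Rightarrow> 'a list) \<times> (('a \<Rightarrow> 'a) \<Rightarrow> 'a list \<Rightarrow> 'a list)) set" where
  "cohom_Aut_rel M A K = {(\<Lambda>, \<Lambda>'). \<Lambda> \<in> Z1_Aut_def M A K \<and> \<Lambda>' \<in> Z1_Aut_def M A K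
     \<and> cohomologous (aut_over M A) (Aut_def M K) (act_map (carrier K)) \<Lambda> \<Lambda>'}"


section \<open>The forms \<open>N\<^sub>\<mu>\<close>\<close>

definition is_form ::
  "('f, 'r, 'a) fo_structure \<Rightarrow> 'a set \<Rightarrow> 'a list monoid \<Rightarrow> 'a list monoid \<Rightarrow> bool" where
  "is_form M A K H \<longleftrightarrow> definable_group M A H \<and> definable_iso M UNIV K H \<noteq> {}"

definition form_cocycle ::
  "('f, 'r, 'a) fo_structure \<Rightarrow> 'a set \<Rightarrow> 'a list monoid \<Rightarrow> ('a list \<Rightarrow> 'a list) \<Rightarrow>
   ('a \<Rightarrow> 'a) \<Rightarrow> 'a list \<Rightarrow> 'a list" where
  "form_cocycle M A K g = (\<lambda>\<sigma> \<in> aut_over M A.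
     compose (carrier K) (inv_into (carrier K) g) (act_map (carrier K) \<sigma> g))"

definition conj_cocycle ::
  "('f, 'r, 'a) fo_structure \<Rightarrow> 'a set \<Rightarrow> 'a list monoid \<Rightarrow> 'a list set \<Rightarrow>
   (('a \<Rightarrow> 'a) \<Rightarrow> 'a list) \<Rightarrow> ('a \<Rightarrow> 'a) \<Rightarrow> 'a list \<Rightarrow> 'a list" where
  "conj_cocycle M A G N \<Phi> =
     (\<lambda>\<sigma> \<in> aut_over M A. \<lambda>n \<in> N. \<Phi> \<sigma> \<otimes>\<^bsub>G\<^esub> n \<otimes>\<^bsub>G\<^esub> inv\<^bsub>G\<^esub> \<Phi> \<sigma>)"

text \<open>\<open>H\<close> is an \<open>A\<close>-form of \<open>N\<close> representing \<open>N\<^sub>\<mu>\<close>: the classes of \<open>g\<^sup>-\<^sup>1 \<circ> \<sigma>(g)\<close> and of \<open>\<Lambda>\<^sub>\<Phi>\<close>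
  agree. Neither class depends on the choice of \<open>g\<close> or of \<open>\<Phi>\<close> in \<open>\<mu>\<close>.\<close>

definition is_twisted_form ::
  "('f, 'r, 'a) fo_structure \<Rightarrow> 'a set \<Rightarrow> 'a list monoid \<Rightarrow> 'a list set \<Rightarrow>
   (('a \<Rightarrow> 'a) \<Rightarrow> 'a list) set \<Rightarrow> 'a list monoid \<Rightarrow> bool" where
  "is_twisted_form M A G N \<mu> H \<longleftrightarrow> is_form M A (G\<lparr>carrier := N\<rparr>) H
     \<and> (\<exists>g \<in> definable_iso M UNIV (G\<lparr>carrier := N\<rparr>) H. \<exists>\<Phi> \<in> \<mu>.
          (form_cocycle M A (G\<lparr>carrier := N\<rparr>) g, conj_cocycle M A G N \<Phi>)
            \<in> cohom_Aut_rel M A (G\<lparr>carrier := N\<rparr>))"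

end

theory Submission
  imports Defs
begin

text \<open>
  The projection of \<open>G\<close> onto \<open>G/N\<close> induces a map from \<open>H\<^sup>1(G)\<close> to the finite set
  \<open>H\<^sup>1(G/N)\<close>, so it suffices that its fibres are finite. Fix a definable cocycle \<open>\<Phi>\<close> and let
  \<open>\<Psi>\<close> have the same image up to coboundary. Lifting that coboundary to \<open>G\<close> replaces \<open>\<Psi>\<close> by a
  cohomologous cocycle of the form \<open>\<Psi>(\<sigma>) = n(\<sigma>) \<Phi>(\<sigma>)\<close> with \<open>n(\<sigma>) \<in> N\<close>
  (\<open>same_image_translate\<close>). The map \<open>n\<close> is a cocycle for the action of the automorphisms on \<open>N\<close>
  twisted by \<open>\<Phi>\<close>: if \<open>g : N \<rightarrow> H\<close> is an isomorphism for which \<open>g\<^sup>-\<^sup>1 \<circ> \<sigma>(g)\<close> is conjugation by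
  \<open>\<Phi>(\<sigma>)\<close>, then \<open>\<sigma> \<mapsto> g(n(\<sigma>))\<close> is a definable cocycle with values in \<open>H\<close>, and its class determines
  the class of \<open>\<Psi>\<close> (\<open>twisted_cocycle\<close>, \<open>twisted_cocycle_reflects\<close>). Such an \<open>H\<close> is a form
  \<open>N\<^sub>\<mu>\<close> for the class \<open>\<mu>\<close> of \<open>\<Phi>\<close> (\<open>is_twisted_form\<close>), so \<open>H\<^sup>1(H)\<close> is finite by hypothesis, and
  hence so is the fibre.

  That \<open>H\<close> exists is where the three model-theoretic hypotheses enter. Write
  \<open>\<Phi>(\<sigma>) = h(a, \<sigma>(a))\<close> with \<open>h\<close> definable over \<open>A\<close>. Atomicity and homogeneity make the orbit of
  \<open>a\<close> definable over \<open>A\<close> (\<open>definable_orbit\<close>), and on this orbit \<open>h\<close> gives elements \<open>f(x,y)\<close> of \<open>G\<close>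
  with \<open>f(x,y) f(y,z) = f(x,z)\<close> and \<open>f(a,\<sigma>(a)) = \<Phi>(\<sigma>)\<close> (\<open>transition_mult\<close>,
  \<open>transition_base\<close>). These are gluing data: \<open>H\<close> is the set of pairs of an orbit point and an element
  of \<open>N\<close>, modulo identifying \<open>(x,n)\<close> with \<open>(y,n')\<close> when \<open>n = f(x,y) n' f(x,y)\<^sup>-\<^sup>1\<close>, and \<open>g(n)\<close> is the
  class of \<open>(a,n)\<close>. Elimination of imaginaries, extended to equivalence relations with parameters
  on definable sets (\<open>definable_quotient\<close>), turns the quotient into a definable set.

  Every claim of definability reduces to writing down a first-order description and applying the
  closure rules for \<open>fol_pred\<close>: connectives, quantifiers over definable sets of tuples, membership
  in definable sets, graphs of definable maps, and substitution of concatenated, truncated and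
  constant tuples.
\<close>

section \<open>Substitution, coincidence and invariance\<close>

text \<open>Renaming variables and plugging in parameters are both instances of simultaneous
  substitution.\<close>

fun subst_term :: "(nat \<Rightarrow> ('f, 'a) fo_term) \<Rightarrow> ('f, 'a) fo_term \<Rightarrow> ('f, 'a) fo_term" where
  "subst_term \<theta> (Var i) = \<theta> i"
| "subst_term \<theta> (Par c) = Par c"
| "subst_term \<theta> (Fn f ts) = Fn f (map (subst_term \<theta>) ts)"

definition lift_term :: "('f, 'a) fo_term \<Rightarrow> ('f, 'a) fo_term" where
  "lift_term = subst_term (\<lambda>i. Var (Suc i))"

fun subst :: "(nat \<Rightarrow> ('f, 'a) fo_term) \<Rightarrow> ('f, 'r, 'a) fo_formula \<Rightarrow> ('f, 'r, 'a) fo_formula" where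
  "subst \<theta> (FRel r ts) = FRel r (map (subst_term \<theta>) ts)"
| "subst \<theta> (FEq t u) = FEq (subst_term \<theta> t) (subst_term \<theta> u)"
| "subst \<theta> (FNeg p) = FNeg (subst \<theta> p)"
| "subst \<theta> (FAnd p q) = FAnd (subst \<theta> p) (subst \<theta> q)"
| "subst \<theta> (FEx p) = FEx (subst (case_nat (Var 0) (\<lambda>i. lift_term (\<theta> i))) p)"

lemma eval_subst_term: "eval M s (subst_term \<theta> t) = eval M (\<lambda>i. eval M s (\<theta> i)) t"
  by (induction t) (auto intro!: arg_cong[where f = "fint M _"])

lemma eval_lift_term: "eval M (case_nat x s) (lift_term t) = eval M s t"
  by (simp add: lift_term_def eval_subst_term)

lemma sat_subst: "sat M s (subst \<theta> p) \<longleftrightarrow> sat M (\<lambda>i. eval M s (\<theta> i)) p"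
proof (induction p arbitrary: \<theta> s)
  case (FRel r ts)
  then show ?case by (simp add: eval_subst_term comp_def)
next
  case (FEx p)
  have "(\<lambda>i. eval M (case_nat x s) (case_nat (Var 0) (\<lambda>i. lift_term (\<theta> i)) i))
      = case_nat x (\<lambda>i. eval M s (\<theta> i))" for x
    by (rule ext) (auto split: nat.split simp: eval_lift_term)
  with FEx show ?case by simp
qed (simp_all add: eval_subst_term)

lemma is_term_mono: "is_term M B n t \<Longrightarrow> B \<subseteq> C \<Longrightarrow> n \<le> k \<Longrightarrow> is_term M C k t"
  by (induction t) auto

lemma is_formula_mono: "is_formula M B n p \<Longrightarrow> B \<subseteq> C \<Longrightarrow> n \<le> k \<Longrightarrow> is_formula M C k p"
  by (induction p arbitrary: n k) (auto intro: is_term_mono)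

lemma is_term_subst_term:
  "is_term M B m t \<Longrightarrow> (\<And>i. i < m \<Longrightarrow> is_term M B n (\<theta> i)) \<Longrightarrow> is_term M B n (subst_term \<theta> t)"
  by (induction t) auto

lemma is_term_lift_term: "is_term M B n t \<Longrightarrow> is_term M B (Suc n) (lift_term t)"
  unfolding lift_term_def by (erule is_term_subst_term) simp

lemma is_formula_subst:
  "is_formula M B m p \<Longrightarrow> (\<And>i. i < m \<Longrightarrow> is_term M B n (\<theta> i)) \<Longrightarrow> is_formula M B n (subst \<theta> p)"
proof (induction p arbitrary: m n \<theta>)
  case (FEx p)
  show ?case
    using FEx.prems
    by (auto intro!: FEx.IH[of "Suc m"] is_term_lift_term split: nat.split)
qed (auto intro: is_term_subst_term)

lemma eval_cong:
  "is_term M B n t \<Longrightarrow> (\<And>i. i < n \<Longrightarrow> s i = s' i) \<Longrightarrow> eval M s t = eval M s' t"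
  by (induction t) (auto intro!: arg_cong[where f = "fint M _"])

lemma sat_cong:
  "is_formula M B n p \<Longrightarrow> (\<And>i. i < n \<Longrightarrow> s i = s' i) \<Longrightarrow> sat M s p = sat M s' p"
proof (induction p arbitrary: n s s')
  case (FRel r ts)
  then have "map (eval M s) ts = map (eval M s') ts"
    by (auto intro: eval_cong)
  then show ?case by (simp only: sat.simps)
next
  case (FEq t u)
  then show ?case using eval_cong[of M B n _ s s'] by simp
next
  case (FEx p)
  have "sat M (case_nat x s) p = sat M (case_nat x s') p" for x
    using FEx.prems by (intro FEx.IH[of "Suc n"]) (auto split: nat.split)
  then show ?case by simp
next
  case (FAnd p q)
  show ?case using FAnd.IH(1,2)[of n s s'] FAnd.prems by simp
next
  case (FNeg p)
  show ?case using FNeg.IH[of n s s'] FNeg.prems by simp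
qed

lemma aut_bij: "\<sigma> \<in> aut_over M A \<Longrightarrow> bij \<sigma>"
  by (simp add: aut_over_def)

lemma eval_aut:
  "\<sigma> \<in> aut_over M A \<Longrightarrow> is_term M A n t \<Longrightarrow> eval M (\<lambda>i. \<sigma> (s i)) t = \<sigma> (eval M s t)"
proof (induction t)
  case (Fn f ts)
  then have "map (eval M (\<lambda>i. \<sigma> (s i))) ts = map \<sigma> (map (eval M s) ts)"
    by simp
  moreover have "fint M f (map \<sigma> (map (eval M s) ts)) = \<sigma> (fint M f (map (eval M s) ts))"
    using Fn.prems unfolding aut_over_def tuples_def by (simp del: map_map)
  ultimately show ?case by (simp del: map_map)
qed (auto simp: aut_over_def)

text \<open>Parameters from \<open>A\<close> are fixed by the automorphisms in question, and surjectivity takes care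
  of the existential quantifier.\<close>

lemma sat_aut:
  "\<sigma> \<in> aut_over M A \<Longrightarrow> is_formula M A n p \<Longrightarrow> sat M (\<lambda>i. \<sigma> (s i)) p \<longleftrightarrow> sat M s p"
proof (induction p arbitrary: n s)
  case (FRel r ts)
  then have "map (eval M (\<lambda>i. \<sigma> (s i))) ts = map \<sigma> (map (eval M s) ts)"
    by (auto intro: eval_aut)
  moreover have "rint M r (map \<sigma> (map (eval M s) ts)) = rint M r (map (eval M s) ts)"
    using FRel.prems unfolding aut_over_def tuples_def by (simp del: map_map)
  ultimately show ?case by (simp del: map_map)
next
  case (FEq t u)
  have "inj \<sigma>" using aut_bij[OF FEq.prems(1)] by (rule bij_is_inj)
  with FEq.prems show ?case
    using eval_aut[OF FEq.prems(1), of n] by (simp add: inj_eq)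
next
  case (FEx p)
  have "(\<lambda>i. \<sigma> (case_nat x s i)) = case_nat (\<sigma> x) (\<lambda>i. \<sigma> (s i))" for x
    by (rule ext) (auto split: nat.split)
  then have *: "sat M (case_nat (\<sigma> x) (\<lambda>i. \<sigma> (s i))) p \<longleftrightarrow> sat M (case_nat x s) p" for x
    using FEx.IH[of "Suc n" "case_nat x s"] FEx.prems by simp
  have "\<exists>x. y = \<sigma> x" for y
    using aut_bij[OF FEx.prems(1)] by (metis bij_pointE)
  with * show ?case by (metis sat.simps(5))
next
  case (FAnd p q)
  show ?case using FAnd.IH(1,2)[of n s] FAnd.prems by simp
next
  case (FNeg p)
  show ?case using FNeg.IH[of n s] FNeg.prems by simp
qed

text \<open>The source of all equivariance below: the graphs of the group operation, of definable maps
  and of the relations describing cocycles are definable over \<open>A\<close>.\<close>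

lemma definable_aut:
  assumes "definable M A X" "\<sigma> \<in> aut_over M A"
  shows "map \<sigma> x \<in> X \<longleftrightarrow> x \<in> X"
proof -
  obtain n p where p: "is_formula M A n p" and X: "X = {x \<in> tuples n. sat M (nth x) p}"
    using assms(1) unfolding definable_def by blast
  show ?thesis
  proof (cases "length x = n")
    case True
    have "sat M (nth (map \<sigma> x)) p \<longleftrightarrow> sat M (\<lambda>i. \<sigma> (x ! i)) p"
      by (rule sat_cong[OF p]) (simp add: True)
    then show ?thesis
      using sat_aut[OF assms(2) p, of "nth x"] True by (simp add: X tuples_def)
  qed (simp add: X tuples_def)
qed

lemma definable_mono: "definable M B X \<Longrightarrow> B \<subseteq> C \<Longrightarrow> definable M C X"
  unfolding definable_def by (blast intro: is_formula_mono)

lemma definable_dim: "definable M B X \<Longrightarrow> \<exists>n. X \<subseteq> tuples n"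
  unfolding definable_def by auto

lemma aut_comp: "\<sigma> \<in> aut_over M A \<Longrightarrow> \<tau> \<in> aut_over M A \<Longrightarrow> \<sigma> \<circ> \<tau> \<in> aut_over M A"
  unfolding aut_over_def tuples_def
  by (auto simp: bij_comp simp flip: map_map)

lemma aut_id: "id \<in> aut_over M A"
  by (auto simp: aut_over_def)

lemma aut_inv:
  assumes "\<sigma> \<in> aut_over M A" shows "inv_into UNIV \<sigma> \<in> aut_over M A"
proof -
  let ?t = "inv_into UNIV \<sigma>"
  have b: "bij \<sigma>" using assms by (rule aut_bij)
  then have st: "\<sigma> (?t x) = x" and ts: "?t (\<sigma> x) = x" for x
    by (simp_all add: bij_is_surj surj_f_inv_f bij_is_inj)
  then have m: "map \<sigma> (map ?t x) = x" for x
    by (simp add: comp_def)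
  have "fint M f (map ?t x) = ?t (fint M f x)" if "f \<in> funs M" "x \<in> tuples (farity M f)" for f x
  proof -
    have "fint M f (map \<sigma> (map ?t x)) = \<sigma> (fint M f (map ?t x))"
      using assms that by (simp add: aut_over_def tuples_def del: map_map)
    then show ?thesis by (metis m ts)
  qed
  moreover have "rint M r (map ?t x) = rint M r x" if "r \<in> rels M" "x \<in> tuples (rarity M r)" for r x
  proof -
    have "rint M r (map \<sigma> (map ?t x)) = rint M r (map ?t x)"
      using assms that by (simp add: aut_over_def tuples_def del: map_map)
    then show ?thesis by (simp only: m)
  qed
  moreover have "?t a = a" if "a \<in> A" for a
    using assms that ts[of a] by (simp add: aut_over_def)
  ultimately show ?thesis
    using bij_imp_bij_inv[OF b] by (simp add: aut_over_def)
qed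

lemma map_aut_inv:
  assumes "\<sigma> \<in> aut_over M A"
  shows "map \<sigma> (map (inv_into UNIV \<sigma>) x) = x" "map (inv_into UNIV \<sigma>) (map \<sigma> x) = x"
  using aut_bij[OF assms]
  by (auto simp: comp_def bij_is_surj surj_f_inv_f bij_is_inj intro: map_idI)

section \<open>A calculus of definable predicates\<close>

text \<open>The predicate speaks about a family of tuples \<open>e 0, e 1, \<dots>\<close> instead of a numbered list of
  single elements. Quantifying over all ways \<open>v\<close> of filling these tuples with terms, whatever
  their lengths, makes closure under substitution immediate, so that no arities have to be
  tracked.\<close>

definition fol_pred ::
  "('f, 'r, 'a) fo_structure \<Rightarrow> 'a set \<Rightarrow> ((nat \<Rightarrow> 'a list) \<Rightarrow> bool) \<Rightarrow> bool" where
  "fol_pred M B P \<longleftrightarrow> (\<forall>n v. (\<forall>i. \<forall>t \<in> set (v i). is_term M B n t) \<longrightarrow>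
     (\<exists>p. is_formula M B n p \<and> (\<forall>s. sat M s p \<longleftrightarrow> P (\<lambda>i. map (eval M s) (v i)))))"

lemma fol_predD:
  assumes "fol_pred M B P" "\<forall>i. \<forall>t \<in> set (v i). is_term M B n t"
  shows "\<exists>p. is_formula M B n p \<and> (\<forall>s. sat M s p \<longleftrightarrow> P (\<lambda>i. map (eval M s) (v i)))"
  using assms unfolding fol_pred_def by blast

text \<open>Expressions for tuples that may be substituted into a definable predicate.\<close>

definition tuple_term ::
  "('f, 'r, 'a) fo_structure \<Rightarrow> 'a set \<Rightarrow> ((nat \<Rightarrow> 'a list) \<Rightarrow> 'a list) \<Rightarrow> bool" where
  "tuple_term M B u \<longleftrightarrow> (\<forall>n v. (\<forall>i. \<forall>t \<in> set (v i). is_term M B n t) \<longrightarrow>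
     (\<exists>ts. (\<forall>t \<in> set ts. is_term M B n t)
        \<and> (\<forall>s. u (\<lambda>i. map (eval M s) (v i)) = map (eval M s) ts)))"

lemma tuple_term_var: "tuple_term M B (\<lambda>e. e i)"
  unfolding tuple_term_def by blast

lemma tuple_term_const: "set c \<subseteq> B \<Longrightarrow> tuple_term M B (\<lambda>e. c)"
  unfolding tuple_term_def by (intro allI impI exI[of _ "map Par c"]) (auto simp: comp_def)

lemma tuple_term_append:
  fixes M :: "('f, 'r, 'a) fo_structure"
  assumes "tuple_term M B t" "tuple_term M B u"
  shows "tuple_term M B (\<lambda>e. t e @ u e)"
  unfolding tuple_term_def
proof (intro allI impI)
  fix n :: nat and v :: "nat \<Rightarrow> ('f, 'a) fo_term list"
  assume "\<forall>i. \<forall>t \<in> set (v i). is_term M B n t"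
  then obtain ts us where
    "\<forall>t \<in> set ts. is_term M B n t" "\<forall>s. t (\<lambda>i. map (eval M s) (v i)) = map (eval M s) ts"
    "\<forall>t \<in> set us. is_term M B n t" "\<forall>s. u (\<lambda>i. map (eval M s) (v i)) = map (eval M s) us"
    using assms unfolding tuple_term_def by metis
  then show "\<exists>ts. (\<forall>t \<in> set ts. is_term M B n t)
        \<and> (\<forall>s. t (\<lambda>i. map (eval M s) (v i)) @ u (\<lambda>i. map (eval M s) (v i)) = map (eval M s) ts)"
    by (intro exI[of _ "ts @ us"]) auto
qed

lemma tuple_term_take:
  fixes M :: "('f, 'r, 'a) fo_structure"
  assumes "tuple_term M B t"
  shows "tuple_term M B (\<lambda>e. take k (t e))"
  unfolding tuple_term_def
proof (intro allI impI)
  fix n :: nat and v :: "nat \<Rightarrow> ('f, 'a) fo_term list"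
  assume "\<forall>i. \<forall>t \<in> set (v i). is_term M B n t"
  then obtain ts where "\<forall>t \<in> set ts. is_term M B n t"
    "\<forall>s. t (\<lambda>i. map (eval M s) (v i)) = map (eval M s) ts"
    using assms unfolding tuple_term_def by blast
  then show "\<exists>ts. (\<forall>t \<in> set ts. is_term M B n t)
      \<and> (\<forall>s. take k (t (\<lambda>i. map (eval M s) (v i))) = map (eval M s) ts)"
    using set_take_subset[of k ts] by (intro exI[of _ "take k ts"]) (auto simp: take_map)
qed

lemma tuple_term_drop:
  fixes M :: "('f, 'r, 'a) fo_structure"
  assumes "tuple_term M B t"
  shows "tuple_term M B (\<lambda>e. drop k (t e))"
  unfolding tuple_term_def
proof (intro allI impI)
  fix n :: nat and v :: "nat \<Rightarrow> ('f, 'a) fo_term list"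
  assume "\<forall>i. \<forall>t \<in> set (v i). is_term M B n t"
  then obtain ts where "\<forall>t \<in> set ts. is_term M B n t"
    "\<forall>s. t (\<lambda>i. map (eval M s) (v i)) = map (eval M s) ts"
    using assms unfolding tuple_term_def by blast
  then show "\<exists>ts. (\<forall>t \<in> set ts. is_term M B n t)
      \<and> (\<forall>s. drop k (t (\<lambda>i. map (eval M s) (v i))) = map (eval M s) ts)"
    using set_drop_subset[of k ts] by (intro exI[of _ "drop k ts"]) (auto simp: drop_map)
qed

lemma fol_pred_subst:
  fixes M :: "('f, 'r, 'a) fo_structure"
  assumes "fol_pred M B P" "\<And>i. tuple_term M B (\<lambda>e. u e i)"
  shows "fol_pred M B (\<lambda>e. P (u e))"
  unfolding fol_pred_def
proof (intro allI impI)
  fix n :: nat and v :: "nat \<Rightarrow> ('f, 'a) fo_term list"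
  assume v: "\<forall>i. \<forall>t \<in> set (v i). is_term M B n t"
  have "\<forall>i. \<exists>ts. (\<forall>t \<in> set ts. is_term M B n t)
        \<and> (\<forall>s. u (\<lambda>i. map (eval M s) (v i)) i = map (eval M s) ts)"
    using assms(2) v unfolding tuple_term_def by blast
  then obtain w where w: "\<forall>i. \<forall>t \<in> set (w i). is_term M B n t"
    and u: "\<And>i s. u (\<lambda>i. map (eval M s) (v i)) i = map (eval M s) (w i)"
    by metis
  have "u (\<lambda>i. map (eval M s) (v i)) = (\<lambda>i. map (eval M s) (w i))" for s
    using u by (intro ext) simp
  then show "\<exists>p. is_formula M B n p \<and> (\<forall>s. sat M s p \<longleftrightarrow> P (u (\<lambda>i. map (eval M s) (v i))))"
    using assms(1) w unfolding fol_pred_def by simp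
qed

lemma fol_pred_subst1:
  assumes "fol_pred M B (\<lambda>e. R (e 0))" "tuple_term M B t"
  shows "fol_pred M B (\<lambda>e. R (t e))"
  using fol_pred_subst[OF assms(1), of "\<lambda>e i. t e"] assms(2) by simp

lemma fol_pred_subst2:
  assumes "fol_pred M B (\<lambda>e. R (e 0) (e 1))" "tuple_term M B t" "tuple_term M B u"
  shows "fol_pred M B (\<lambda>e. R (t e) (u e))"
proof -
  have "tuple_term M B (\<lambda>e. if i = 0 then t e else u e)" for i :: nat
    using assms(2,3) by (cases "i = 0") simp_all
  from fol_pred_subst[OF assms(1), of "\<lambda>e i. if i = 0 then t e else u e", OF this]
  show ?thesis by simp
qed

lemma fol_pred_subst3:
  assumes "fol_pred M B (\<lambda>e. R (e 0) (e 1) (e 2))"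
    "tuple_term M B t" "tuple_term M B u" "tuple_term M B w"
  shows "fol_pred M B (\<lambda>e. R (t e) (u e) (w e))"
proof -
  have "tuple_term M B (\<lambda>e. if i = 0 then t e else if i = 1 then u e else w e)" for i :: nat
    using assms(2-4) by (cases "i = 0"; cases "i = 1") simp_all
  from fol_pred_subst[OF assms(1),
      of "\<lambda>e i. if i = 0 then t e else if i = 1 then u e else w e", OF this]
  show ?thesis by simp
qed

lemma fol_pred_not: "fol_pred M B P \<Longrightarrow> fol_pred M B (\<lambda>e. \<not> P e)"
  unfolding fol_pred_def by (metis is_formula.simps(3) sat.simps(3))

lemma fol_pred_conj:
  fixes M :: "('f, 'r, 'a) fo_structure"
  assumes "fol_pred M B P" "fol_pred M B Q"
  shows "fol_pred M B (\<lambda>e. P e \<and> Q e)"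
  unfolding fol_pred_def
proof (intro allI impI)
  fix n :: nat and v :: "nat \<Rightarrow> ('f, 'a) fo_term list"
  assume v: "\<forall>i. \<forall>t \<in> set (v i). is_term M B n t"
  obtain p q where
    "is_formula M B n p" "\<forall>s. sat M s p \<longleftrightarrow> P (\<lambda>i. map (eval M s) (v i))"
    "is_formula M B n q" "\<forall>s. sat M s q \<longleftrightarrow> Q (\<lambda>i. map (eval M s) (v i))"
    using fol_predD[OF assms(1) v] fol_predD[OF assms(2) v] by blast
  then show "\<exists>p. is_formula M B n p \<and>
      (\<forall>s. sat M s p \<longleftrightarrow> P (\<lambda>i. map (eval M s) (v i)) \<and> Q (\<lambda>i. map (eval M s) (v i)))"
    by (intro exI[of _ "FAnd p q"]) simp
qed

lemma fol_pred_iff: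
  assumes "fol_pred M B P" "fol_pred M B Q"
  shows "fol_pred M B (\<lambda>e. P e \<longleftrightarrow> Q e)"
proof -
  have "fol_pred M B (\<lambda>e. \<not> (P e \<and> \<not> Q e) \<and> \<not> (Q e \<and> \<not> P e))"
    by (intro fol_pred_not fol_pred_conj assms)
  moreover have "(\<lambda>e. \<not> (P e \<and> \<not> Q e) \<and> \<not> (Q e \<and> \<not> P e)) = (\<lambda>e. P e \<longleftrightarrow> Q e)"
    by auto
  ultimately show ?thesis by simp
qed

lemma fol_pred_const:
  fixes M :: "('f, 'r, 'a) fo_structure"
  shows "fol_pred M B (\<lambda>e. b)"
proof -
  have "is_formula M B n (FEx (FEq (Var 0) (Var 0)))" "sat M s (FEx (FEq (Var 0) (Var 0)))"
    for n and s :: "nat \<Rightarrow> 'a"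
    by auto
  then have T: "fol_pred M B (\<lambda>e. True)"
    unfolding fol_pred_def by blast
  show ?thesis
    using T fol_pred_not[OF T] by (cases b) simp_all
qed

text \<open>A block of \<open>k\<close> quantifiers binds the variables below \<open>k\<close> at once.\<close>

lemma sat_FEx_iterate:
  fixes M :: "('f, 'r, 'b) fo_structure"
  shows "sat M s ((FEx ^^ k) p) \<longleftrightarrow> (\<exists>s'. (\<forall>i. s' (k + i) = s i) \<and> sat M s' p)"
proof (induction k arbitrary: s)
  case 0
  have "(\<forall>i. s' i = s i) \<longleftrightarrow> s' = s" for s' :: "nat \<Rightarrow> 'b" by auto
  then show ?case by simp
next
  case (Suc k)
  have "(\<exists>x. \<forall>i. s' (k + i) = case_nat x s i) \<longleftrightarrow> (\<forall>i. s' (Suc k + i) = s i)" for s' :: "nat \<Rightarrow> 'b"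
  proof
    assume "\<forall>i. s' (Suc k + i) = s i"
    then have "\<forall>i. s' (k + i) = case_nat (s' k) s i"
      by (auto split: nat.split)
    then show "\<exists>x. \<forall>i. s' (k + i) = case_nat x s i" ..
  qed (metis add_Suc add_Suc_right old.nat.simps(5))
  then show ?case by (simp add: Suc) blast
qed

lemma is_formula_FEx_iterate: "is_formula M B (k + n) p \<Longrightarrow> is_formula M B n ((FEx ^^ k) p)"
  by (induction k arbitrary: n) simp_all

text \<open>In the premise the bound tuple has become number \<open>0\<close> and the others have moved up by one. As
  the rule is used backwards, unification computes this shift.\<close>

lemma fol_pred_ex:
  fixes M :: "('f, 'r, 'a) fo_structure"
  assumes "fol_pred M B (\<lambda>e. Q (\<lambda>i. e (Suc i)) (e 0))"
  shows "fol_pred M B (\<lambda>e. \<exists>y \<in> tuples k. Q e y)"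
  unfolding fol_pred_def
proof (intro allI impI)
  fix n :: nat and v :: "nat \<Rightarrow> ('f, 'a) fo_term list"
  assume v: "\<forall>i. \<forall>t \<in> set (v i). is_term M B n t"
  \<comment> \<open>The bound tuple takes the variables below \<open>k\<close>; the old variables move up by \<open>k\<close>.\<close>
  define w where "w = case_nat (map Var [0..<k]) (\<lambda>i. map (subst_term (\<lambda>j. Var (k + j))) (v i))"
  have "\<forall>i. \<forall>t \<in> set (w i). is_term M B (k + n) t"
    using v unfolding w_def
    by (auto split: nat.split intro: is_term_subst_term[of M B n])
  then obtain p where p: "is_formula M B (k + n) p"
    and sat: "\<And>s. sat M s p \<longleftrightarrow> Q (\<lambda>i. map (eval M s) (w (Suc i))) (map (eval M s) (w 0))"
    using assms unfolding fol_pred_def by blast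
  have w: "Q (\<lambda>i. map (eval M s) (w (Suc i))) (map (eval M s) (w 0))
      \<longleftrightarrow> Q (\<lambda>i. map (eval M (\<lambda>j. s (k + j))) (v i)) (map s [0..<k])" for s
    by (simp add: w_def eval_subst_term comp_def)
  have "sat M s ((FEx ^^ k) p) \<longleftrightarrow> (\<exists>y \<in> tuples k. Q (\<lambda>i. map (eval M s) (v i)) y)" for s
  proof
    assume "sat M s ((FEx ^^ k) p)"
    then obtain s' where s': "(\<lambda>i. s' (k + i)) = s" "sat M s' p"
      unfolding sat_FEx_iterate by auto
    then have "Q (\<lambda>i. map (eval M s) (v i)) (map s' [0..<k])"
      using sat[of s'] w[of s'] by simp
    moreover have "map s' [0..<k] \<in> tuples k"
      by (simp add: tuples_def)
    ultimately show "\<exists>y \<in> tuples k. Q (\<lambda>i. map (eval M s) (v i)) y" ..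
  next
    assume "\<exists>y \<in> tuples k. Q (\<lambda>i. map (eval M s) (v i)) y"
    then obtain y where y: "length y = k" "Q (\<lambda>i. map (eval M s) (v i)) y"
      by (auto simp: tuples_def)
    define s' where "s' i = (if i < k then y ! i else s (i - k))" for i
    have "map s' [0..<k] = y"
      using y(1) by (intro nth_equalityI) (simp_all add: s'_def)
    moreover have "(\<lambda>j. s' (k + j)) = s"
      by (simp add: s'_def)
    ultimately have "sat M s' p"
      using sat[of s'] w[of s'] y(2) by simp
    then show "sat M s ((FEx ^^ k) p)"
      unfolding sat_FEx_iterate by (intro exI[of _ s']) (simp add: s'_def)
  qed
  then show "\<exists>p. is_formula M B n p \<and>
      (\<forall>s. sat M s p \<longleftrightarrow> (\<exists>y \<in> tuples k. Q (\<lambda>i. map (eval M s) (v i)) y))"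
    using is_formula_FEx_iterate[OF p] by blast
qed

lemma fol_pred_all:
  assumes "fol_pred M B (\<lambda>e. Q (\<lambda>i. e (Suc i)) (e 0))"
  shows "fol_pred M B (\<lambda>e. \<forall>y \<in> tuples k. Q e y)"
  using fol_pred_not[OF fol_pred_ex[OF fol_pred_not[OF assms], of k]] by simp

lemma fol_pred_mem:
  fixes M :: "('f, 'r, 'a) fo_structure"
  assumes X: "definable M B X" and t: "tuple_term M B t"
  shows "fol_pred M B (\<lambda>e. t e \<in> X)"
proof -
  obtain m p where p: "is_formula M B m p" and X: "X = {x \<in> tuples m. sat M (nth x) p}"
    using X unfolding definable_def by blast
  have "fol_pred M B (\<lambda>e. e 0 \<in> X)"
    unfolding fol_pred_def
  proof (intro allI impI)
    fix n :: nat and v :: "nat \<Rightarrow> ('f, 'a) fo_term list"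
    assume v: "\<forall>i. \<forall>t \<in> set (v i). is_term M B n t"
    show "\<exists>p. is_formula M B n p \<and> (\<forall>s. sat M s p \<longleftrightarrow> map (eval M s) (v 0) \<in> X)"
    proof (cases "length (v 0) = m")
      case True
      have "is_formula M B n (subst (nth (v 0)) p)"
        using v True by (intro is_formula_subst[OF p]) (metis nth_mem)
      moreover have "sat M s (subst (nth (v 0)) p) \<longleftrightarrow> map (eval M s) (v 0) \<in> X" for s
      proof -
        have "sat M (\<lambda>i. eval M s (v 0 ! i)) p = sat M (nth (map (eval M s) (v 0))) p"
          by (rule sat_cong[OF p]) (simp add: True)
        then show ?thesis
          by (simp add: sat_subst X tuples_def True)
      qed
      ultimately show ?thesis by blast
    next
      case False
      then have "\<forall>s. map (eval M s) (v 0) \<notin> X"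
        by (simp add: X tuples_def)
      then show ?thesis
        using fol_predD[OF fol_pred_const v, of False] by simp
    qed
  qed
  then show ?thesis using t by (rule fol_pred_subst1)
qed

lemma definable_fol_pred:
  fixes M :: "('f, 'r, 'a) fo_structure"
  assumes "fol_pred M B (\<lambda>e. P (e 0))"
  shows "definable M B {x \<in> tuples n. P x}"
proof -
  define v where "v = (\<lambda>i::nat. map Var [0..<n] :: ('f, 'a) fo_term list)"
  have "\<forall>i. \<forall>t \<in> set (v i). is_term M B n t"
    by (auto simp: v_def)
  then obtain p where p: "is_formula M B n p" "\<And>s. sat M s p \<longleftrightarrow> P (map (eval M s) (v 0))"
    using assms unfolding fol_pred_def by blast
  have "map (eval M (nth x)) (v 0) = x" if "length x = n" for x
    unfolding v_def using that by (intro nth_equalityI) simp_all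
  then show ?thesis
    unfolding definable_def using p by (intro exI[of _ n] exI[of _ p]) (auto simp: tuples_def)
qed

lemma definable_pairs:
  assumes "fol_pred M B (\<lambda>e. R (e 0) (e 1))"
  shows "definable M B {x @ y | x y. x \<in> tuples m \<and> y \<in> tuples n \<and> R x y}"
proof -
  have "fol_pred M B (\<lambda>e. R (take m (e 0)) (drop m (e 0)))"
    by (intro fol_pred_subst2[OF assms] tuple_term_take tuple_term_drop tuple_term_var)
  then have "definable M B {w \<in> tuples (m + n). R (take m w) (drop m w)}"
    by (rule definable_fol_pred)
  moreover have "{w \<in> tuples (m + n). R (take m w) (drop m w)}
      = {x @ y | x y. x \<in> tuples m \<and> y \<in> tuples n \<and> R x y}"
  proof (intro equalityI subsetI)
    fix w assume "w \<in> {w \<in> tuples (m + n). R (take m w) (drop m w)}"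
    then have "w = take m w @ drop m w \<and> take m w \<in> tuples m \<and> drop m w \<in> tuples n
        \<and> R (take m w) (drop m w)"
      by (simp add: tuples_def)
    then show "w \<in> {x @ y | x y. x \<in> tuples m \<and> y \<in> tuples n \<and> R x y}" by blast
  qed (auto simp: tuples_def)
  ultimately show ?thesis by simp
qed

text \<open>A concatenated pair can be taken apart once the length of its first component is known.\<close>

lemma append_mem_iff:
  assumes "\<And>x y. P x y \<Longrightarrow> length x = n" "length x = n"
  shows "x @ z \<in> {x @ y | x y. P x y} \<longleftrightarrow> P x z"
proof
  assume "x @ z \<in> {x @ y | x y. P x y}"
  then obtain x' y' where "x @ z = x' @ y'" "P x' y'"
    by blast
  moreover from this have "length x' = n"
    using assms(1) by blast
  ultimately show "P x z"
    using assms(2) by simp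
qed blast

lemma definable_tuples: "definable M B (tuples n)"
  using definable_fol_pred[OF fol_pred_const[of M B True], of n] by simp

lemma fol_pred_tuples: "tuple_term M B t \<Longrightarrow> fol_pred M B (\<lambda>e. t e \<in> tuples n)"
  by (rule fol_pred_mem[OF definable_tuples])

lemma fol_pred_ex_mem:
  assumes "definable M B X" "fol_pred M B (\<lambda>e. Q (\<lambda>i. e (Suc i)) (e 0))"
  shows "fol_pred M B (\<lambda>e. \<exists>y \<in> X. Q e y)"
proof -
  obtain n where n: "X \<subseteq> tuples n"
    using definable_dim[OF assms(1)] ..
  have "fol_pred M B (\<lambda>e. \<exists>y \<in> tuples n. y \<in> X \<and> Q e y)"
    by (intro fol_pred_ex fol_pred_conj fol_pred_mem assms tuple_term_var)
  moreover have "(\<exists>y \<in> tuples n. y \<in> X \<and> Q e y) \<longleftrightarrow> (\<exists>y \<in> X. Q e y)" for e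
    using n by blast
  ultimately show ?thesis by simp
qed

lemma fol_pred_eq:
  fixes M :: "('f, 'r, 'a) fo_structure"
  assumes "tuple_term M B t" "tuple_term M B u"
  shows "fol_pred M B (\<lambda>e. t e = u e)"
proof -
  have "fol_pred M B (\<lambda>e. e 0 = e 1)"
    unfolding fol_pred_def
  proof (intro allI impI)
    fix n :: nat and v :: "nat \<Rightarrow> ('f, 'a) fo_term list"
    assume v: "\<forall>i. \<forall>t \<in> set (v i). is_term M B n t"
    have "\<exists>p. is_formula M B n p \<and> (\<forall>s. sat M s p \<longleftrightarrow> map (eval M s) ts = map (eval M s) us)"
      if "\<forall>t \<in> set ts. is_term M B n t" "\<forall>t \<in> set us. is_term M B n t" for ts us
      using that
    proof (induction ts us rule: list_induct2')
      case 1
      then show ?case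
        using fol_predD[OF fol_pred_const v, of True] by simp
    next
      case (2 t ts)
      then show ?case
        using fol_predD[OF fol_pred_const v, of False] by simp
    next
      case (3 u us)
      then show ?case
        using fol_predD[OF fol_pred_const v, of False] by simp
    next
      case (4 t ts u us)
      then obtain p where
        "is_formula M B n p" "\<forall>s. sat M s p \<longleftrightarrow> map (eval M s) ts = map (eval M s) us"
        by auto
      with 4 show ?case
        by (intro exI[of _ "FAnd (FEq t u) p"]) simp
    qed
    then show "\<exists>p. is_formula M B n p \<and>
        (\<forall>s. sat M s p \<longleftrightarrow> map (eval M s) (v 0) = map (eval M s) (v 1))"
      using v by blast
  qed
  then show ?thesis using assms by (rule fol_pred_subst2)
qed

lemma fol_pred_pmap:
  assumes h: "definable_pmap M B h" and tu: "tuple_term M B t" "tuple_term M B u"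
  shows "fol_pred M B (\<lambda>e. h (t e) = Some (u e))"
proof -
  obtain m where m: "dom h \<subseteq> tuples m" and d: "definable M B {x @ y | x y. h x = Some y}"
    using h unfolding definable_pmap_def by blast
  have len: "length x = m" if "h x = Some y" for x y
    using m that by (auto simp: tuples_def)
  have "x \<in> tuples m \<and> x @ y \<in> {x @ y | x y. h x = Some y} \<longleftrightarrow> h x = Some y" for x y
  proof (cases "length x = m")
    case True
    then show ?thesis
      using append_mem_iff[of "\<lambda>x y. h x = Some y" m x y] len by (simp add: tuples_def)
  next
    case False
    then show ?thesis
      using len by (auto simp: tuples_def)
  qed
  moreover have "fol_pred M B (\<lambda>e. t e \<in> tuples m \<and> t e @ u e \<in> {x @ y | x y. h x = Some y})"
    by (intro fol_pred_conj fol_pred_mem[OF d] fol_pred_tuples tuple_term_append tu)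
  ultimately show ?thesis by simp
qed

text \<open>A constant of its own, because an inlined conjunction would be taken apart by
  \<open>fol_pred_conj\<close> when the closure rules are applied.\<close>

definition graph_rel :: "'b set \<Rightarrow> ('b \<Rightarrow> 'c) \<Rightarrow> 'b \<Rightarrow> 'c \<Rightarrow> bool" where
  "graph_rel X f x y \<longleftrightarrow> x \<in> X \<and> f x = y"

lemma fol_pred_graph:
  assumes "definable_map M B X f" "tuple_term M B t" "tuple_term M B u"
  shows "fol_pred M B (\<lambda>e. graph_rel X f (t e) (u e))"
proof -
  have "((Some \<circ> f) |` X) x = Some y \<longleftrightarrow> graph_rel X f x y" for x y
    by (auto simp: graph_rel_def restrict_map_def)
  then show ?thesis
    using fol_pred_pmap[of M B "(Some \<circ> f) |` X" t u] assms by (simp add: definable_map_def)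
qed

text \<open>Requiring the value to be unique turns any definable relation into a definable map.\<close>

lemma definable_pmap_of_fol_pred:
  assumes "fol_pred M B (\<lambda>e. R (e 0) (e 1))"
  shows "\<exists>h. definable_pmap M B h \<and>
    (\<forall>x \<in> tuples m. \<forall>y \<in> tuples n. h x = Some y \<longleftrightarrow> R x y \<and> (\<forall>z \<in> tuples n. R x z \<longrightarrow> z = y))"
proof -
  define U where "U x y \<longleftrightarrow> x \<in> tuples m \<and> y \<in> tuples n \<and> R x y
    \<and> \<not> (\<exists>z \<in> tuples n. R x z \<and> \<not> z = y)" for x y
  define h where "h x = (if \<exists>y. U x y then Some (THE y. U x y) else None)" for x
  have "y = z" if "U x y" "U x z" for x y z
    using that by (auto simp: U_def)
  then have h: "h x = Some y \<longleftrightarrow> U x y" for x y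
    unfolding h_def by (metis (mono_tags, lifting) option.distinct(1) option.inject theI)
  have "fol_pred M B (\<lambda>e. U (e 0) (e 1))"
    unfolding U_def
    by (intro fol_pred_conj fol_pred_not fol_pred_ex fol_pred_eq fol_pred_tuples
        fol_pred_subst2[OF assms] tuple_term_var)
  from definable_pairs[OF this, of m n] have d: "definable M B {x @ y | x y. h x = Some y}"
  proof (rule back_subst[of "definable M B"])
    show "{x @ y | x y. x \<in> tuples m \<and> y \<in> tuples n \<and> U x y} = {x @ y | x y. h x = Some y}"
      unfolding h U_def by blast
  qed
  have "dom h \<subseteq> tuples m" "ran h \<subseteq> tuples n"
    by (auto simp: ran_def h U_def)
  with d have "definable_pmap M B h"
    unfolding definable_pmap_def by blast
  moreover have "\<forall>x \<in> tuples m. \<forall>y \<in> tuples n.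
      h x = Some y \<longleftrightarrow> R x y \<and> (\<forall>z \<in> tuples n. R x z \<longrightarrow> z = y)"
    by (auto simp: h U_def)
  ultimately show ?thesis by blast
qed

lemma definable_map_of_fol_pred:
  assumes X: "definable M B X" and f: "f ` X \<subseteq> tuples n"
    and R: "fol_pred M B (\<lambda>e. R (e 0) (e 1))"
    and eq: "\<And>x y. x \<in> X \<Longrightarrow> y \<in> tuples n \<Longrightarrow> R x y \<longleftrightarrow> y = f x"
  shows "definable_map M B X f"
proof -
  obtain m where m: "X \<subseteq> tuples m"
    using definable_dim[OF X] ..
  have "fol_pred M B (\<lambda>e. e 0 \<in> X \<and> R (e 0) (e 1))"
    by (intro fol_pred_conj fol_pred_mem[OF X] R tuple_term_var)
  from definable_pairs[OF this, of m n]
  have d: "definable M B {x @ y | x y. ((Some \<circ> f) |` X) x = Some y}"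
  proof (rule back_subst[of "definable M B"])
    have "x \<in> tuples m \<and> y \<in> tuples n \<and> x \<in> X \<and> R x y \<longleftrightarrow> ((Some \<circ> f) |` X) x = Some y" for x y
      using m f eq[of x y] by (auto simp: restrict_map_def)
    then show "{x @ y | x y. x \<in> tuples m \<and> y \<in> tuples n \<and> x \<in> X \<and> R x y}
        = {x @ y | x y. ((Some \<circ> f) |` X) x = Some y}"
      by simp
  qed
  have "dom ((Some \<circ> f) |` X) \<subseteq> tuples m" "ran ((Some \<circ> f) |` X) \<subseteq> tuples n"
    using m f by (auto simp: ran_def restrict_map_def split: if_splits)
  with d show ?thesis
    unfolding definable_map_def definable_pmap_def by blast
qed

text \<open>The concatenated tuples in the graph split uniquely because all arguments have the same
  length.\<close>

lemma definable_map_aut: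
  assumes f: "definable_map M A X f" and X: "x \<in> X" and s: "\<sigma> \<in> aut_over M A"
  shows "map \<sigma> x \<in> X" "f (map \<sigma> x) = map \<sigma> (f x)"
proof -
  let ?h = "(Some \<circ> f) |` X"
  obtain m where m: "dom ?h \<subseteq> tuples m" and d: "definable M A {x @ y | x y. ?h x = Some y}"
    using f unfolding definable_map_def definable_pmap_def by blast
  have "x @ f x \<in> {x @ y | x y. ?h x = Some y}"
    using X by (auto simp: restrict_map_def)
  then have "map \<sigma> (x @ f x) \<in> {x @ y | x y. ?h x = Some y}"
    using definable_aut[OF d s] by blast
  then obtain x' where x': "map \<sigma> x @ map \<sigma> (f x) = x' @ f x'" "x' \<in> X"
    by (auto simp: restrict_map_def split: if_splits)
  have "X \<subseteq> tuples m"
    using m by (auto simp: dom_def restrict_map_def split: if_splits)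
  then have "length x = length x'"
    using X x'(2) by (auto simp: tuples_def)
  with x' show "map \<sigma> x \<in> X" "f (map \<sigma> x) = map \<sigma> (f x)"
    by auto
qed

lemma definable_map_mono:
  assumes "definable_map M B X f" "B \<subseteq> C"
  shows "definable_map M C X f"
  using assms definable_mono unfolding definable_map_def definable_pmap_def by blast

lemma definable_map_dim: "definable_map M B X f \<Longrightarrow> \<exists>n. f ` X \<subseteq> tuples n"
  unfolding definable_map_def definable_pmap_def
  by (fastforce simp: ran_def restrict_map_def split: if_splits)

section \<open>Elimination of imaginaries over a parameter set\<close>

text \<open>Parameters become variables: the parameter \<open>b\<close> is replaced by variable number \<open>n + g b\<close>,
  where \<open>n\<close> counts the variables in scope and grows under binders.\<close>

fun abstract_term :: "('a \<Rightarrow> nat) \<Rightarrow> nat \<Rightarrow> ('f, 'a) fo_term \<Rightarrow> ('f, 'a) fo_term" where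
  "abstract_term g n (Var i) = Var i"
| "abstract_term g n (Par b) = Var (n + g b)"
| "abstract_term g n (Fn f ts) = Fn f (map (abstract_term g n) ts)"

fun abstract_pars :: "('a \<Rightarrow> nat) \<Rightarrow> nat \<Rightarrow> ('f, 'r, 'a) fo_formula \<Rightarrow> ('f, 'r, 'a) fo_formula" where
  "abstract_pars g n (FRel r ts) = FRel r (map (abstract_term g n) ts)"
| "abstract_pars g n (FEq t u) = FEq (abstract_term g n t) (abstract_term g n u)"
| "abstract_pars g n (FNeg p) = FNeg (abstract_pars g n p)"
| "abstract_pars g n (FAnd p q) = FAnd (abstract_pars g n p) (abstract_pars g n q)"
| "abstract_pars g n (FEx p) = FEx (abstract_pars g (Suc n) p)"

lemma eval_abstract_term:
  "is_term M B n t \<Longrightarrow> (\<And>b. b \<in> B \<Longrightarrow> s (n + g b) = b) \<Longrightarrow>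
    eval M s (abstract_term g n t) = eval M s t"
  by (induction t) (auto intro!: arg_cong[where f = "fint M _"])

lemma sat_abstract_pars:
  "is_formula M B n p \<Longrightarrow> (\<And>b. b \<in> B \<Longrightarrow> s (n + g b) = b) \<Longrightarrow>
    sat M s (abstract_pars g n p) \<longleftrightarrow> sat M s p"
proof (induction p arbitrary: n s)
  case (FRel r ts)
  then have "map (eval M s) (map (abstract_term g n) ts) = map (eval M s) ts"
    by (auto intro: eval_abstract_term)
  then show ?case by (simp only: sat.simps abstract_pars.simps)
next
  case (FEq t u)
  then show ?case using eval_abstract_term[of M B n _ s g] by simp
next
  case (FNeg p)
  show ?case using FNeg.IH[of n s] FNeg.prems by simp
next
  case (FAnd p q)
  show ?case using FAnd.IH(1,2)[of n s] FAnd.prems by simp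
next
  case (FEx p)
  show ?case using FEx.IH[of "Suc n" "case_nat _ s"] FEx.prems by simp
qed

lemma is_formula_abstract_pars:
  assumes g: "\<And>b. b \<in> B \<Longrightarrow> g b < k"
  shows "is_formula M B n p \<Longrightarrow> is_formula M {} (n + k) (abstract_pars g n p)"
proof -
  have t: "is_term M B n t \<Longrightarrow> is_term M {} (n + k) (abstract_term g n t)" for n t
    by (induction t) (auto simp: g)
  show "is_formula M B n p \<Longrightarrow> is_formula M {} (n + k) (abstract_pars g n p)"
  proof (induction p arbitrary: n)
    case (FEx p)
    show ?case using FEx.IH[of "Suc n"] FEx.prems by simp
  qed (auto simp: t)
qed

lemma is_formula_finite_pars:
  assumes "is_formula M A n p"
  shows "\<exists>B. finite B \<and> B \<subseteq> A \<and> is_formula M B n p"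
proof -
  have t: "is_term M A n t \<Longrightarrow> set2_fo_term t \<subseteq> C \<Longrightarrow> is_term M (A \<inter> C) n t" for n t C
    by (induction t) auto
  have "is_formula M A n p \<Longrightarrow> set3_fo_formula p \<subseteq> C \<Longrightarrow> is_formula M (A \<inter> C) n p" for C
  proof (induction p arbitrary: n)
    case (FRel r ts)
    then show ?case by (fastforce intro: t)
  qed (auto intro: t)
  moreover have "finite (set2_fo_term t)" for t :: "('f, 'a) fo_term"
    by (induction t) auto
  then have "finite (set3_fo_formula p)"
    by (induction p) auto
  ultimately show ?thesis
    using assms by (intro exI[of _ "A \<inter> set3_fo_formula p"]) auto
qed

text \<open>A formula uses finitely many parameters, which can be collected in a single tuple \<open>c\<close>.\<close>

lemma definable_abstract_pars:
  assumes "definable M A X"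
  shows "\<exists>c Y. set c \<subseteq> A \<and> definable M {} Y \<and> (\<forall>x. x \<in> X \<longleftrightarrow> x @ c \<in> Y)"
proof -
  obtain n p where "is_formula M A n p" and X: "X = {x \<in> tuples n. sat M (nth x) p}"
    using assms unfolding definable_def by blast
  then obtain B where B: "finite B" "B \<subseteq> A" and p: "is_formula M B n p"
    using is_formula_finite_pars by metis
  then obtain c where c: "set c = B"
    using finite_list by metis
  have "\<exists>i. i < length c \<and> c ! i = b" if "b \<in> B" for b
    using that c by (metis in_set_conv_nth)
  then obtain g where g: "\<And>b. b \<in> B \<Longrightarrow> g b < length c" "\<And>b. b \<in> B \<Longrightarrow> c ! g b = b"
    by metis
  let ?q = "abstract_pars g n p"
  have q: "is_formula M {} (n + length c) ?q"
    by (rule is_formula_abstract_pars[OF g(1) p])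
  have "sat M (nth (x @ c)) ?q \<longleftrightarrow> sat M (nth x) p" if "length x = n" for x
  proof -
    have "sat M (nth (x @ c)) ?q \<longleftrightarrow> sat M (nth (x @ c)) p"
      by (rule sat_abstract_pars[OF p]) (simp add: that[symmetric] g)
    also have "\<dots> \<longleftrightarrow> sat M (nth x) p"
      by (rule sat_cong[OF p]) (simp add: nth_append that)
    finally show ?thesis .
  qed
  then have "x \<in> X \<longleftrightarrow> x @ c \<in> {x \<in> tuples (n + length c). sat M (nth x) ?q}" for x
    by (auto simp: X tuples_def)
  moreover have "definable M {} {x \<in> tuples (n + length c). sat M (nth x) ?q}"
    unfolding definable_def using q by blast
  ultimately show ?thesis
    using c B(2) by blast
qed

text \<open>Elimination of imaginaries is given for relations without parameters on a full power of the
  universe. The parameters \<open>c\<close> of \<open>E\<close> are therefore treated as additional coordinates. For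
  other values of these coordinates the formula need not define an equivalence relation, so
  pairs are compared by the sets that they define instead; for the given \<open>c\<close> and on \<open>D\<close>,
  equality of these sets is \<open>E\<close>.\<close>

lemma definable_quotient:
  assumes ei: "eliminates_imaginaries M" and D: "definable M A D"
    and E: "fol_pred M A (\<lambda>e. E (e 0) (e 1))"
    and refl: "\<And>x. x \<in> D \<Longrightarrow> E x x"
    and sym: "\<And>x y. x \<in> D \<Longrightarrow> y \<in> D \<Longrightarrow> E x y \<Longrightarrow> E y x"
    and trans: "\<And>x y z. x \<in> D \<Longrightarrow> y \<in> D \<Longrightarrow> z \<in> D \<Longrightarrow> E x y \<Longrightarrow> E y z \<Longrightarrow> E x z"
  shows "\<exists>f. definable_map M A D f \<and> (\<forall>x \<in> D. \<forall>y \<in> D. E x y \<longleftrightarrow> f x = f y)"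
proof -
  obtain n where n: "D \<subseteq> tuples n"
    using definable_dim[OF D] ..
  have "fol_pred M A (\<lambda>e. e 0 \<in> D \<and> e 1 \<in> D \<and> E (e 0) (e 1))"
    by (intro fol_pred_conj fol_pred_mem[OF D] tuple_term_var E)
  from definable_abstract_pars[OF definable_pairs[OF this, of n n]]
  obtain c Y where c: "set c \<subseteq> A" and Y: "definable M {} Y"
    and XY: "\<forall>x. x \<in> {x @ y | x y. x \<in> tuples n \<and> y \<in> tuples n \<and> x \<in> D \<and> y \<in> D \<and> E x y}
      \<longleftrightarrow> x @ c \<in> Y"
    by (elim exE conjE) (rule that)
  have row: "x @ z @ c \<in> Y \<longleftrightarrow> z \<in> D \<and> E x z" if "x \<in> D" for x z
  proof -
    have "x @ z @ c \<in> Y \<longleftrightarrow> x \<in> tuples n \<and> z \<in> tuples n \<and> x \<in> D \<and> z \<in> D \<and> E x z"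
      using XY[rule_format, of "x @ z"] that n
      by (subst (asm) append_mem_iff[where n = n]) (auto simp: tuples_def)
    then show ?thesis
      using that n by blast
  qed
  define k where "k = length c"
  define R where "R u v \<longleftrightarrow> drop n u = drop n v
    \<and> (\<forall>z \<in> tuples n. take n u @ z @ drop n u \<in> Y \<longleftrightarrow> take n v @ z @ drop n v \<in> Y)" for u v
  define E' where "E' = {(u, v). u \<in> tuples (n + k) \<and> v \<in> tuples (n + k) \<and> R u v}"
  \<comment> \<open>Having the same parameters and the same row is equality of \<open>\<kappa>\<close>.\<close>
  define \<kappa> where "\<kappa> u = (drop n u, {z \<in> tuples n. take n u @ z @ drop n u \<in> Y})" for u
  have R_iff: "R u v \<longleftrightarrow> \<kappa> u = \<kappa> v" for u v
    unfolding R_def \<kappa>_def prod.inject Set.set_eq_iff mem_Collect_eq by blast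
  have "equiv (tuples (n + k)) E'"
  proof (rule equivI)
    show "E' \<subseteq> tuples (n + k) \<times> tuples (n + k)"
      by (auto simp: E'_def)
    show "refl_on (tuples (n + k)) E'"
      by (auto simp: refl_on_def E'_def R_iff)
    show "sym_on UNIV E'"
      by (auto simp: sym_on_def E'_def R_iff)
    show "trans_on UNIV E'"
      by (auto simp: trans_on_def E'_def R_iff)
  qed
  moreover have "fol_pred M {} (\<lambda>e. R (e 0) (e 1))"
    unfolding R_def
    by (intro fol_pred_conj fol_pred_eq fol_pred_all fol_pred_iff fol_pred_mem[OF Y]
        tuple_term_append tuple_term_take tuple_term_drop tuple_term_var)
  from definable_pairs[OF this] have "definable M {} {x @ y | x y. (x, y) \<in> E'}"
    by (simp add: E'_def)
  ultimately have "\<exists>f. definable_map M {} (tuples (n + k)) f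
      \<and> (\<forall>u \<in> tuples (n + k). \<forall>v \<in> tuples (n + k). (u, v) \<in> E' \<longleftrightarrow> f u = f v)"
    using ei unfolding eliminates_imaginaries_def by simp
  then obtain f0 where f0: "definable_map M {} (tuples (n + k)) f0"
    and eq: "\<And>u v. u \<in> tuples (n + k) \<Longrightarrow> v \<in> tuples (n + k) \<Longrightarrow> (u, v) \<in> E' \<longleftrightarrow> f0 u = f0 v"
    by blast
  define f where "f x = f0 (x @ c)" for x
  have dom: "x @ c \<in> tuples (n + k)" if "x \<in> D" for x
    using that n by (auto simp: tuples_def k_def)
  obtain l where l: "f0 ` tuples (n + k) \<subseteq> tuples l"
    using definable_map_dim[OF f0] ..
  have "definable_map M A D f"
  proof (rule definable_map_of_fol_pred[OF D])
    show "f ` D \<subseteq> tuples l"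
      using l dom by (auto simp: f_def)
    show "fol_pred M A (\<lambda>e. graph_rel (tuples (n + k)) f0 (e 0 @ c) (e 1))"
      by (intro fol_pred_graph[OF definable_map_mono[OF f0]] tuple_term_append tuple_term_const
          tuple_term_var c) simp
    show "graph_rel (tuples (n + k)) f0 (x @ c) y \<longleftrightarrow> y = f x" if "x \<in> D" for x y
      using dom[OF that] by (auto simp: graph_rel_def f_def)
  qed
  moreover have "E x y \<longleftrightarrow> f x = f y" if "x \<in> D" "y \<in> D" for x y
  proof -
    have "length x = n" "length y = n"
      using that n by (auto simp: tuples_def)
    then have "f x = f y \<longleftrightarrow> (\<forall>z \<in> tuples n. x @ z @ c \<in> Y \<longleftrightarrow> y @ z @ c \<in> Y)"
      using eq[OF dom dom, OF that] dom[OF that(1)] dom[OF that(2)] by (simp add: f_def E'_def R_def)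
    also have "\<dots> \<longleftrightarrow> (\<forall>z \<in> D. E x z \<longleftrightarrow> E y z)"
      using n by (auto simp: row that)
    also have "\<dots> \<longleftrightarrow> E x y"
      using that refl sym trans by blast
    finally show ?thesis ..
  qed
  ultimately show ?thesis by blast
qed

section \<open>Orbits of tuples\<close>

text \<open>A formula isolating the type of \<open>a\<close> defines the set of tuples of the same type, which by
  homogeneity is the orbit.\<close>

lemma definable_orbit:
  assumes "atomic_over M A" "homogeneous_over M A"
  shows "definable M A ((\<lambda>\<sigma>. map \<sigma> a) ` aut_over M A)"
proof -
  obtain p where p: "p \<in> tp M A a"
    and iso: "\<And>q x. q \<in> tp M A a \<Longrightarrow> x \<in> tuples (length a) \<Longrightarrow> sat M (nth x) p \<Longrightarrow> sat M (nth x) q"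
    using assms(1) unfolding atomic_over_def isolated_type_def by metis
  have pf: "is_formula M A (length a) p" "sat M (nth a) p"
    using p by (auto simp: tp_def)
  let ?X = "{x \<in> tuples (length a). sat M (nth x) p}"
  have X: "definable M A ?X"
    unfolding definable_def using pf(1) by blast
  have "?X = (\<lambda>\<sigma>. map \<sigma> a) ` aut_over M A"
  proof (intro equalityI subsetI)
    fix x assume x: "x \<in> ?X"
    have "tp M A a = tp M A x"
    proof (intro equalityI subsetI)
      fix q assume "q \<in> tp M A a"
      with x iso[of q x] show "q \<in> tp M A x"
        by (auto simp: tp_def tuples_def)
    next
      fix q assume q: "q \<in> tp M A x"
      show "q \<in> tp M A a"
      proof (rule ccontr)
        assume "q \<notin> tp M A a"
        then have "FNeg q \<in> tp M A a"
          using q x by (auto simp: tp_def tuples_def)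
        then show False
          using iso[of "FNeg q" x] x q by (auto simp: tp_def)
      qed
    qed
    then have "\<exists>\<sigma> \<in> aut_over M A. map \<sigma> a = x"
      using assms(2) x unfolding homogeneous_over_def by (simp add: tuples_def)
    then show "x \<in> (\<lambda>\<sigma>. map \<sigma> a) ` aut_over M A" by blast
  next
    fix x assume "x \<in> (\<lambda>\<sigma>. map \<sigma> a) ` aut_over M A"
    then show "x \<in> ?X"
      using definable_aut[OF X, of _ a] pf(2) by (auto simp: tuples_def)
  qed
  with X show ?thesis by simp
qed

section \<open>Definable groups and their cocycles\<close>

text \<open>Kept opaque for the same reason as \<open>graph_rel\<close>.\<close>

definition mult_rel :: "'b monoid \<Rightarrow> 'b \<Rightarrow> 'b \<Rightarrow> 'b \<Rightarrow> bool" where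
  "mult_rel G x y z \<longleftrightarrow> x \<in> carrier G \<and> y \<in> carrier G \<and> x \<otimes>\<^bsub>G\<^esub> y = z"

locale definable_grp = group G
  for M :: "('f, 'r, 'a) fo_structure" and A :: "'a set" and G :: "'a list monoid" (structure) +
  assumes definable_group: "definable_group M A G"
begin

lemma definable_carrier: "definable M A (carrier G)"
  using definable_group by (simp add: definable_group_def)

lemma aut_closed [simp, intro]: "\<sigma> \<in> aut_over M A \<Longrightarrow> x \<in> carrier G \<Longrightarrow> map \<sigma> x \<in> carrier G"
  using definable_aut[OF definable_carrier] by blast

lemma mult_graphE:
  obtains n X where "carrier G \<subseteq> tuples n" "definable M A X"
    "\<And>x y z. x \<in> tuples n \<Longrightarrow> y \<in> tuples n \<Longrightarrow> x @ y @ z \<in> X \<longleftrightarrow> mult_rel G x y z"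
proof -
  obtain n where n: "carrier G \<subseteq> tuples n"
    using definable_dim[OF definable_carrier] ..
  have "x @ y @ z \<in> {x @ y @ (x \<otimes> y) | x y. x \<in> carrier G \<and> y \<in> carrier G} \<longleftrightarrow> mult_rel G x y z"
    if "x \<in> tuples n" "y \<in> tuples n" for x y z
  proof
    assume "x @ y @ z \<in> {x @ y @ (x \<otimes> y) | x y. x \<in> carrier G \<and> y \<in> carrier G}"
    then obtain x' y' where *: "x @ y @ z = x' @ y' @ (x' \<otimes> y')" "x' \<in> carrier G" "y' \<in> carrier G"
      by blast
    then have "length x' = length x" "length y' = length y"
      using n that by (auto simp: tuples_def)
    with * show "mult_rel G x y z"
      by (simp add: mult_rel_def)
  qed (auto simp: mult_rel_def)
  moreover have "definable M A {x @ y @ (x \<otimes> y) | x y. x \<in> carrier G \<and> y \<in> carrier G}"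
    using definable_group by (simp add: definable_group_def)
  ultimately show thesis
    using that n by blast
qed

lemma fol_pred_mult:
  assumes "tuple_term M A t" "tuple_term M A u" "tuple_term M A w"
  shows "fol_pred M A (\<lambda>e. mult_rel G (t e) (u e) (w e))"
proof -
  obtain n X where n: "carrier G \<subseteq> tuples n" and X: "definable M A X"
    and eq: "\<And>x y z. x \<in> tuples n \<Longrightarrow> y \<in> tuples n \<Longrightarrow> x @ y @ z \<in> X \<longleftrightarrow> mult_rel G x y z"
    by (rule mult_graphE) (rule that)
  have "fol_pred M A (\<lambda>e. t e \<in> tuples n \<and> u e \<in> tuples n \<and> t e @ u e @ w e \<in> X)"
    by (intro fol_pred_conj fol_pred_tuples fol_pred_mem[OF X] tuple_term_append assms)
  moreover have "t e \<in> tuples n \<and> u e \<in> tuples n \<and> t e @ u e @ w e \<in> X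
      \<longleftrightarrow> mult_rel G (t e) (u e) (w e)" for e
    using n eq[of "t e" "u e" "w e"] by (auto simp: mult_rel_def)
  ultimately show ?thesis by simp
qed

lemma aut_mult:
  assumes s: "\<sigma> \<in> aut_over M A" and x: "x \<in> carrier G" and y: "y \<in> carrier G"
  shows "map \<sigma> (x \<otimes> y) = map \<sigma> x \<otimes> map \<sigma> y"
proof -
  obtain n X where n: "carrier G \<subseteq> tuples n" and X: "definable M A X"
    and eq: "\<And>x y z. x \<in> tuples n \<Longrightarrow> y \<in> tuples n \<Longrightarrow> x @ y @ z \<in> X \<longleftrightarrow> mult_rel G x y z"
    by (rule mult_graphE) (rule that)
  have "x @ y @ (x \<otimes> y) \<in> X"
    using n x y by (subst eq) (auto simp: mult_rel_def)
  then have "map \<sigma> x @ map \<sigma> y @ map \<sigma> (x \<otimes> y) \<in> X"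
    using definable_aut[OF X s, of "x @ y @ (x \<otimes> y)"] by simp
  then have "mult_rel G (map \<sigma> x) (map \<sigma> y) (map \<sigma> (x \<otimes> y))"
    using n x y by (subst (asm) eq) (auto simp: tuples_def)
  then show ?thesis by (simp add: mult_rel_def)
qed

lemma cancel_inv:
  assumes "x \<in> carrier G" "y \<in> carrier G"
  shows "x \<otimes> (inv x \<otimes> y) = y" "inv x \<otimes> (x \<otimes> y) = y"
  using assms by (simp_all flip: m_assoc)

lemma mult_eq_iff:
  assumes "x \<in> carrier G" "y \<in> carrier G" "z \<in> carrier G"
  shows "x \<otimes> y = z \<longleftrightarrow> y = inv x \<otimes> z"
  using assms by (auto simp: cancel_inv)

lemma mult_eq_iff_right:
  assumes "x \<in> carrier G" "y \<in> carrier G" "z \<in> carrier G"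
  shows "x \<otimes> y = z \<longleftrightarrow> x = z \<otimes> inv y"
  using assms by (auto simp: m_assoc)

text \<open>Conjugation described by multiplications only, the form in which the closure rules can treat
  it.\<close>

lemma mult_rel_conj:
  assumes "c \<in> carrier G" "n \<in> carrier G"
  shows "(\<exists>w \<in> carrier G. mult_rel G c n w \<and> mult_rel G y c w) \<longleftrightarrow> y = c \<otimes> n \<otimes> inv c"
proof -
  have "(\<exists>w \<in> carrier G. mult_rel G c n w \<and> mult_rel G y c w) \<longleftrightarrow> y \<in> carrier G \<and> y \<otimes> c = c \<otimes> n"
    using assms by (auto simp: mult_rel_def)
  also have "\<dots> \<longleftrightarrow> y = c \<otimes> n \<otimes> inv c"
    using assms mult_eq_iff_right[of y c "c \<otimes> n"] by auto
  finally show ?thesis .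
qed

lemma aut_hom: "\<sigma> \<in> aut_over M A \<Longrightarrow> map \<sigma> \<in> hom G G"
  by (auto simp: hom_def aut_mult)

lemma aut_one [simp]: "\<sigma> \<in> aut_over M A \<Longrightarrow> map \<sigma> \<one> = \<one>"
  by (rule hom_one[OF aut_hom is_group is_group])

lemma aut_m_inv:
  assumes "\<sigma> \<in> aut_over M A" "x \<in> carrier G"
  shows "map \<sigma> (inv x) = inv (map \<sigma> x)"
proof -
  interpret group_hom G G "map \<sigma>"
    using aut_hom[OF assms(1)] by unfold_locales
  show ?thesis using hom_inv[OF assms(2)] .
qed

lemma cocycle_closed:
  "\<Phi> \<in> cocycles (aut_over M A) G map \<Longrightarrow> \<sigma> \<in> aut_over M A \<Longrightarrow> \<Phi> \<sigma> \<in> carrier G"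
  by (auto simp: cocycles_def)

lemma Z1_def_closed: "\<Phi> \<in> Z1_def M A G \<Longrightarrow> \<sigma> \<in> aut_over M A \<Longrightarrow> \<Phi> \<sigma> \<in> carrier G"
  by (auto simp: Z1_def_def cocycle_closed)

lemma Z1_def_comp:
  "\<Phi> \<in> Z1_def M A G \<Longrightarrow> \<sigma> \<in> aut_over M A \<Longrightarrow> \<tau> \<in> aut_over M A \<Longrightarrow>
    \<Phi> (\<sigma> \<circ> \<tau>) = \<Phi> \<sigma> \<otimes> map \<sigma> (\<Phi> \<tau>)"
  by (simp add: Z1_def_def cocycles_def)

text \<open>Relations compose better than partial functions on concatenated tuples: new cocycles are
  described by quantifying over the values of the given ones.\<close>

lemma Z1_defE:
  assumes "\<Phi> \<in> Z1_def M A G"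
  obtains a R where "fol_pred M A (\<lambda>e. R (e 0) (e 1) (e 2))"
    "\<And>\<sigma> z. \<sigma> \<in> aut_over M A \<Longrightarrow> R a (map \<sigma> a) z \<longleftrightarrow> z = \<Phi> \<sigma>"
proof -
  obtain a h where h: "definable_pmap M A h"
    "\<And>\<sigma>. \<sigma> \<in> aut_over M A \<Longrightarrow> h (a @ map \<sigma> a) = Some (\<Phi> \<sigma>)"
    using assms by (auto simp: Z1_def_def)
  show thesis
  proof (rule that[of "\<lambda>x y z. h (x @ y) = Some z" a])
    show "fol_pred M A (\<lambda>e. h (e 0 @ e 1) = Some (e 2))"
      by (intro fol_pred_pmap[OF h(1)] tuple_term_append tuple_term_var)
  qed (auto simp: h(2))
qed

text \<open>Conversely, outside the pairs \<open>(a, \<sigma> a)\<close> the relation may have no solution or several; the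
  partial function is then undefined.\<close>

lemma Z1_defI:
  assumes \<Phi>: "\<Phi> \<in> cocycles (aut_over M A) G map"
    and R: "fol_pred M A (\<lambda>e. R (e 0) (e 1) (e 2))"
    and eq: "\<And>\<sigma> z. \<sigma> \<in> aut_over M A \<Longrightarrow> z \<in> carrier G \<Longrightarrow> R a (map \<sigma> a) z \<longleftrightarrow> z = \<Phi> \<sigma>"
  shows "\<Phi> \<in> Z1_def M A G"
proof -
  obtain n where n: "carrier G \<subseteq> tuples n"
    using definable_dim[OF definable_carrier] ..
  let ?k = "length a"
  have "fol_pred M A (\<lambda>e. e 1 \<in> carrier G \<and> R (take ?k (e 0)) (drop ?k (e 0)) (e 1))"
    by (intro fol_pred_conj fol_pred_mem[OF definable_carrier] fol_pred_subst3[OF R]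
        tuple_term_take tuple_term_drop tuple_term_var)
  from definable_pmap_of_fol_pred[OF this, of "?k + ?k" n] obtain h where h: "definable_pmap M A h"
    "\<And>x y. x \<in> tuples (?k + ?k) \<Longrightarrow> y \<in> tuples n \<Longrightarrow> h x = Some y \<longleftrightarrow>
      (y \<in> carrier G \<and> R (take ?k x) (drop ?k x) y) \<and>
      (\<forall>z \<in> tuples n. z \<in> carrier G \<and> R (take ?k x) (drop ?k x) z \<longrightarrow> z = y)"
    by blast
  have "h (a @ map \<sigma> a) = Some (\<Phi> \<sigma>)" if "\<sigma> \<in> aut_over M A" for \<sigma>
    using that n cocycle_closed[OF \<Phi> that] by (subst h(2)) (auto simp: tuples_def eq)
  with \<Phi> h(1) show ?thesis
    by (auto simp: Z1_def_def)
qed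

abbreviation "H1_rel \<equiv> {(\<Phi>, \<Psi>). \<Phi> \<in> Z1_def M A G \<and> \<Psi> \<in> Z1_def M A G
  \<and> cohomologous (aut_over M A) G map \<Phi> \<Psi>}"

text \<open>Free of inverses, this form makes reflexivity, symmetry and transitivity short calculations.\<close>

lemma cohomologous_iff:
  assumes "\<Phi> \<in> Z1_def M A G" "\<Psi> \<in> Z1_def M A G"
  shows "cohomologous (aut_over M A) G map \<Phi> \<Psi> \<longleftrightarrow>
    (\<exists>b \<in> carrier G. \<forall>\<sigma> \<in> aut_over M A. b \<otimes> \<Psi> \<sigma> = \<Phi> \<sigma> \<otimes> map \<sigma> b)"
proof -
  have "\<Psi> \<sigma> = inv b \<otimes> \<Phi> \<sigma> \<otimes> map \<sigma> b \<longleftrightarrow> b \<otimes> \<Psi> \<sigma> = \<Phi> \<sigma> \<otimes> map \<sigma> b"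
    if "b \<in> carrier G" "\<sigma> \<in> aut_over M A" for b \<sigma>
    using that Z1_def_closed[OF assms(1)] Z1_def_closed[OF assms(2)]
    by (simp add: m_assoc mult_eq_iff)
  then show ?thesis
    unfolding cohomologous_def by auto
qed

lemma equiv_H1_rel: "equiv (Z1_def M A G) H1_rel"
proof (rule equivI)
  show "H1_rel \<subseteq> Z1_def M A G \<times> Z1_def M A G"
    by blast
  show "refl_on (Z1_def M A G) H1_rel"
    by (auto simp: refl_on_def cohomologous_iff Z1_def_closed intro!: bexI[of _ \<one>])
  show "sym_on UNIV H1_rel"
  proof (rule symI, clarsimp simp: cohomologous_iff)
    fix \<Phi> \<Psi> b assume h: "\<Phi> \<in> Z1_def M A G" "\<Psi> \<in> Z1_def M A G" "b \<in> carrier G"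
      "\<forall>\<sigma> \<in> aut_over M A. b \<otimes> \<Psi> \<sigma> = \<Phi> \<sigma> \<otimes> map \<sigma> b"
    have "inv b \<otimes> \<Phi> \<sigma> = \<Psi> \<sigma> \<otimes> map \<sigma> (inv b)" if s: "\<sigma> \<in> aut_over M A" for \<sigma>
    proof -
      note c = h(3) aut_closed[OF s h(3)] Z1_def_closed[OF h(1) s] Z1_def_closed[OF h(2) s]
      have "\<Phi> \<sigma> = b \<otimes> \<Psi> \<sigma> \<otimes> inv (map \<sigma> b)"
        using h(4) s c by (simp add: m_assoc)
      then show ?thesis
        using c s by (simp add: m_assoc aut_m_inv inv_solve_left')
    qed
    with h(3) show "\<exists>b \<in> carrier G. \<forall>\<sigma> \<in> aut_over M A. b \<otimes> \<Phi> \<sigma> = \<Psi> \<sigma> \<otimes> map \<sigma> b"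
      by (intro bexI[of _ "inv b"]) auto
  qed
  show "trans_on UNIV H1_rel"
  proof (rule transI, clarsimp simp: cohomologous_iff)
    fix \<Phi> \<Psi> \<Theta> b c assume h: "\<Phi> \<in> Z1_def M A G" "\<Psi> \<in> Z1_def M A G" "\<Theta> \<in> Z1_def M A G"
      "b \<in> carrier G" "c \<in> carrier G" "\<forall>\<sigma> \<in> aut_over M A. b \<otimes> \<Psi> \<sigma> = \<Phi> \<sigma> \<otimes> map \<sigma> b"
      "\<forall>\<sigma> \<in> aut_over M A. c \<otimes> \<Theta> \<sigma> = \<Psi> \<sigma> \<otimes> map \<sigma> c"
    have "b \<otimes> c \<otimes> \<Theta> \<sigma> = \<Phi> \<sigma> \<otimes> map \<sigma> (b \<otimes> c)" if s: "\<sigma> \<in> aut_over M A" for \<sigma>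
    proof -
      note cl = h(4,5) aut_closed[OF s h(4)] aut_closed[OF s h(5)] Z1_def_closed[OF h(1) s]
        Z1_def_closed[OF h(2) s] Z1_def_closed[OF h(3) s]
      have "b \<otimes> c \<otimes> \<Theta> \<sigma> = (b \<otimes> \<Psi> \<sigma>) \<otimes> map \<sigma> c"
        using h(7) s cl by (simp add: m_assoc)
      then show ?thesis
        using h(6) s cl by (simp add: m_assoc aut_mult)
    qed
    with h(4,5) show "\<exists>b \<in> carrier G. \<forall>\<sigma> \<in> aut_over M A. b \<otimes> \<Theta> \<sigma> = \<Phi> \<sigma> \<otimes> map \<sigma> b"
      by (intro bexI[of _ "b \<otimes> c"]) auto
  qed
qed

text \<open>The translating element \<open>b\<close> is moved by the automorphisms; it joins the tuple \<open>a\<close> that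
  determines the cocycle, and \<open>\<sigma> b\<close> is then available as part of \<open>\<sigma> (a @ b)\<close>.\<close>

lemma Z1_def_translate:
  assumes \<Phi>: "\<Phi> \<in> Z1_def M A G" and b: "b \<in> carrier G"
  shows "(\<lambda>\<sigma> \<in> aut_over M A. inv b \<otimes> \<Phi> \<sigma> \<otimes> map \<sigma> b) \<in> Z1_def M A G" (is "?\<Psi> \<in> _")
    and "(\<Phi>, \<lambda>\<sigma> \<in> aut_over M A. inv b \<otimes> \<Phi> \<sigma> \<otimes> map \<sigma> b) \<in> H1_rel"
proof -
  obtain a R where R: "fol_pred M A (\<lambda>e. R (e 0) (e 1) (e 2))"
    and eq: "\<And>\<sigma> z. \<sigma> \<in> aut_over M A \<Longrightarrow> R a (map \<sigma> a) z \<longleftrightarrow> z = \<Phi> \<sigma>"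
    by (rule Z1_defE[OF \<Phi>]) (rule that)
  let ?k = "length a"
  show 1: "?\<Psi> \<in> Z1_def M A G"
  proof (rule Z1_defI[where a = "a @ b"])
    show "?\<Psi> \<in> cocycles (aut_over M A) G map"
      unfolding cocycles_def
    proof (intro CollectI conjI ballI)
      show "?\<Psi> \<in> aut_over M A \<rightarrow>\<^sub>E carrier G"
        using b Z1_def_closed[OF \<Phi>] by auto
      fix \<sigma> \<tau> assume s: "\<sigma> \<in> aut_over M A" and t: "\<tau> \<in> aut_over M A"
      note cl = b aut_closed[OF s b] aut_closed[OF s aut_closed[OF t b]]
        Z1_def_closed[OF \<Phi> s] Z1_def_closed[OF \<Phi> t] aut_closed[OF s Z1_def_closed[OF \<Phi> t]]
      have "map \<sigma> (inv b \<otimes> \<Phi> \<tau> \<otimes> map \<tau> b)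
          = inv (map \<sigma> b) \<otimes> map \<sigma> (\<Phi> \<tau>) \<otimes> map \<sigma> (map \<tau> b)"
        using cl s aut_closed[OF t b] by (simp add: aut_mult aut_m_inv del: map_map)
      then have "inv b \<otimes> \<Phi> (\<sigma> \<circ> \<tau>) \<otimes> map \<sigma> (map \<tau> b)
          = (inv b \<otimes> \<Phi> \<sigma> \<otimes> map \<sigma> b) \<otimes> map \<sigma> (inv b \<otimes> \<Phi> \<tau> \<otimes> map \<tau> b)"
        using cl by (simp add: Z1_def_comp[OF \<Phi> s t] m_assoc cancel_inv del: map_map)
      then show "?\<Psi> (\<sigma> \<circ> \<tau>) = ?\<Psi> \<sigma> \<otimes> map \<sigma> (?\<Psi> \<tau>)"
        using s t aut_comp[OF s t] by (simp only: restrict_apply' map_map)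
    qed
    show "fol_pred M A (\<lambda>e. \<exists>f \<in> carrier G. R (take ?k (e 0)) (take ?k (e 1)) f \<and>
        (\<exists>w \<in> carrier G. mult_rel G (drop ?k (e 0)) (e 2) w \<and> mult_rel G f (drop ?k (e 1)) w))"
      by (intro fol_pred_ex_mem[OF definable_carrier] fol_pred_conj fol_pred_subst3[OF R]
          fol_pred_mult tuple_term_take tuple_term_drop tuple_term_var)
    fix \<sigma> z assume s: "\<sigma> \<in> aut_over M A" and z: "z \<in> carrier G"
    have "b \<otimes> z = \<Phi> \<sigma> \<otimes> map \<sigma> b \<longleftrightarrow> z = inv b \<otimes> \<Phi> \<sigma> \<otimes> map \<sigma> b"
      using z b s Z1_def_closed[OF \<Phi> s] by (simp add: m_assoc mult_eq_iff)
    then show "(\<exists>f \<in> carrier G. R (take ?k (a @ b)) (take ?k (map \<sigma> (a @ b))) f \<and>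
        (\<exists>w \<in> carrier G. mult_rel G (drop ?k (a @ b)) z w \<and> mult_rel G f (drop ?k (map \<sigma> (a @ b))) w))
        \<longleftrightarrow> z = ?\<Psi> \<sigma>"
      using s z b Z1_def_closed[OF \<Phi> s] by (auto simp: eq mult_rel_def)
  qed
  then show "(\<Phi>, ?\<Psi>) \<in> H1_rel"
    using \<Phi> b by (auto simp: cohomologous_def)
qed

end

lemma definable_grpI: "definable_group M A G \<Longrightarrow> definable_grp M A G"
  by (simp add: definable_grp_def definable_grp_axioms_def definable_group_def)

text \<open>The three tuples are concatenated and recovered by their lengths, so that invariance of
  definable sets applies.\<close>

lemma fol_pred_aut3:
  assumes R: "fol_pred M A (\<lambda>e. R (e 0) (e 1) (e 2))" and s: "\<sigma> \<in> aut_over M A"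
  shows "R (map \<sigma> x) (map \<sigma> y) (map \<sigma> z) \<longleftrightarrow> R x y z"
proof -
  let ?k = "length x" and ?l = "length y" and ?m = "length z"
  have "fol_pred M A (\<lambda>e. R (take ?k (e 0)) (take ?l (drop ?k (e 0))) (drop (?k + ?l) (e 0)))"
    by (intro fol_pred_subst3[OF R] tuple_term_take tuple_term_drop tuple_term_var)
  from definable_aut[OF definable_fol_pred[OF this, of "?k + ?l + ?m"] s, of "x @ y @ z"]
  show ?thesis
    by (simp add: tuples_def)
qed

section \<open>Transition elements of a cocycle\<close>

text \<open>The data of a definable cocycle in the relational form: \<open>\<Phi> \<sigma>\<close> is determined by \<open>(a, \<sigma> a)\<close>
  through \<open>R\<close>, and the orbit of \<open>a\<close> is definable.\<close>

locale cocycle_twist = definable_grp M A G + normal N G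
  for M :: "('f, 'r, 'a) fo_structure" and A :: "'a set" and G :: "'a list monoid" (structure)
    and N :: "'a list set" +
  fixes \<Phi> :: "('a \<Rightarrow> 'a) \<Rightarrow> 'a list" and a :: "'a list"
    and R :: "'a list \<Rightarrow> 'a list \<Rightarrow> 'a list \<Rightarrow> bool"
  assumes definable_N: "definable M A N"
    and \<Phi>: "\<Phi> \<in> Z1_def M A G"
    and R: "fol_pred M A (\<lambda>e. R (e 0) (e 1) (e 2))"
    and R_iff: "\<And>\<sigma> z. \<sigma> \<in> aut_over M A \<Longrightarrow> R a (map \<sigma> a) z \<longleftrightarrow> z = \<Phi> \<sigma>"
    and definable_orbit_a: "definable M A ((\<lambda>\<sigma>. map \<sigma> a) ` aut_over M A)"
begin

definition orbit :: "'a list set" where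
  "orbit = (\<lambda>\<sigma>. map \<sigma> a) ` aut_over M A"

text \<open>The element by which the copies of \<open>N\<close> sitting over the orbit points \<open>x\<close> and \<open>y\<close> are glued.\<close>

definition transition :: "'a list \<Rightarrow> 'a list \<Rightarrow> 'a list" where
  "transition x y = (THE z. R x y z)"

abbreviation k :: nat where "k \<equiv> length a"

lemma orbitE: assumes "x \<in> orbit" obtains \<sigma> where "\<sigma> \<in> aut_over M A" "x = map \<sigma> a"
  using assms unfolding orbit_def by blast

lemma orbitI: "\<sigma> \<in> aut_over M A \<Longrightarrow> map \<sigma> a \<in> orbit"
  unfolding orbit_def by blast

lemma a_in_orbit: "a \<in> orbit"
  using orbitI[OF aut_id] by simp

lemma orbit_length: "x \<in> orbit \<Longrightarrow> length x = k"
  by (auto elim: orbitE)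

lemma in_N [simp]: "n \<in> N \<Longrightarrow> n \<in> carrier G"
  using subset by blast

lemma map_in_N: "\<sigma> \<in> aut_over M A \<Longrightarrow> n \<in> N \<Longrightarrow> map \<sigma> n \<in> N"
  using definable_aut[OF definable_N] by blast

text \<open>By invariance of \<open>R\<close> the first point may be moved back to \<open>a\<close>, where \<open>R\<close> describes \<open>\<Phi>\<close>.\<close>

lemma R_aut:
  assumes "\<sigma> \<in> aut_over M A" "\<tau> \<in> aut_over M A"
  shows "R (map \<sigma> a) (map \<tau> a) z \<longleftrightarrow> z = map \<sigma> (\<Phi> (inv_into UNIV \<sigma> \<circ> \<tau>))"
proof -
  let ?t = "inv_into UNIV \<sigma>"
  have "R (map \<sigma> a) (map \<tau> a) z \<longleftrightarrow> R (map \<sigma> a) (map \<sigma> (map ?t (map \<tau> a))) (map \<sigma> (map ?t z))"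
    by (simp only: map_aut_inv[OF assms(1)])
  also have "\<dots> \<longleftrightarrow> R a (map (?t \<circ> \<tau>) a) (map ?t z)"
    unfolding fol_pred_aut3[OF R assms(1)] by simp
  also have "\<dots> \<longleftrightarrow> map ?t z = \<Phi> (?t \<circ> \<tau>)"
    by (rule R_iff) (intro aut_comp aut_inv assms)
  also have "\<dots> \<longleftrightarrow> z = map \<sigma> (\<Phi> (?t \<circ> \<tau>))"
    using map_aut_inv[OF assms(1)] by metis
  finally show ?thesis .
qed

lemma transition_aut:
  assumes "\<sigma> \<in> aut_over M A" "\<tau> \<in> aut_over M A"
  shows "transition (map \<sigma> a) (map \<tau> a) = map \<sigma> (\<Phi> (inv_into UNIV \<sigma> \<circ> \<tau>))"
  unfolding transition_def R_aut[OF assms] by simp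

lemma R_transition: "x \<in> orbit \<Longrightarrow> y \<in> orbit \<Longrightarrow> R x y z \<longleftrightarrow> z = transition x y"
  by (elim orbitE) (simp add: R_aut transition_aut)

lemma transition_closed [simp]: "x \<in> orbit \<Longrightarrow> y \<in> orbit \<Longrightarrow> transition x y \<in> carrier G"
  by (elim orbitE) (simp add: transition_aut Z1_def_closed[OF \<Phi>] aut_comp aut_inv)

lemma transition_base: "\<sigma> \<in> aut_over M A \<Longrightarrow> transition a (map \<sigma> a) = \<Phi> \<sigma>"
  using R_transition[OF a_in_orbit orbitI, of \<sigma> "\<Phi> \<sigma>"] R_iff[of \<sigma>] by simp

text \<open>For \<open>x = \<rho> a\<close>, \<open>y = \<sigma> a\<close>, \<open>z = \<tau> a\<close> this is the cocycle identity for \<open>\<rho>\<^sup>-\<^sup>1\<tau> =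
  (\<rho>\<^sup>-\<^sup>1\<sigma>)(\<sigma>\<^sup>-\<^sup>1\<tau>)\<close>, moved by \<open>\<rho>\<close>.\<close>

lemma transition_mult:
  assumes "x \<in> orbit" "y \<in> orbit" "z \<in> orbit"
  shows "transition x y \<otimes> transition y z = transition x z"
proof -
  obtain \<rho> \<sigma> \<tau> where r: "\<rho> \<in> aut_over M A" "x = map \<rho> a" and s: "\<sigma> \<in> aut_over M A" "y = map \<sigma> a"
    and t: "\<tau> \<in> aut_over M A" "z = map \<tau> a"
    using assms by (elim orbitE) blast
  let ?u = "inv_into UNIV \<rho> \<circ> \<sigma>" and ?v = "inv_into UNIV \<sigma> \<circ> \<tau>"
  have u: "?u \<in> aut_over M A" and v: "?v \<in> aut_over M A"
    using r s t by (simp_all add: aut_comp aut_inv)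
  have "\<sigma> \<circ> inv_into UNIV \<sigma> = id" "\<rho> \<circ> inv_into UNIV \<rho> = id"
    using bij_is_surj[OF aut_bij[OF s(1)]] bij_is_surj[OF aut_bij[OF r(1)]]
    by (simp_all only: surj_iff)
  then have uv: "?u \<circ> ?v = inv_into UNIV \<rho> \<circ> \<tau>" and ru: "\<rho> \<circ> ?u = \<sigma>"
    by (metis comp_assoc comp_id, metis comp_assoc id_comp)
  have "map \<rho> (\<Phi> (?u \<circ> ?v)) = map \<rho> (\<Phi> ?u) \<otimes> map \<rho> (map ?u (\<Phi> ?v))"
    unfolding Z1_def_comp[OF \<Phi> u v]
    by (intro aut_mult r(1) aut_closed u Z1_def_closed[OF \<Phi>] v)
  also have "map \<rho> (map ?u (\<Phi> ?v)) = map \<sigma> (\<Phi> ?v)"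
    by (simp only: map_map ru)
  finally show ?thesis
    by (simp only: uv r(2) s(2) t(2) transition_aut[OF r(1) s(1)] transition_aut[OF s(1) t(1)]
        transition_aut[OF r(1) t(1)])
qed

lemma transition_refl: "x \<in> orbit \<Longrightarrow> transition x x = \<one>"
  using transition_mult[of x x x] by (simp add: l_cancel_one')

lemma transition_sym: "x \<in> orbit \<Longrightarrow> y \<in> orbit \<Longrightarrow> transition y x = inv (transition x y)"
  using transition_mult[of y x y] transition_refl[of y] by (simp add: inv_equality)

section \<open>The quotient by the twisted equivalence relation\<close>

text \<open>The disjoint union of copies of \<open>N\<close>, one over each point of the orbit.\<close>

definition D :: "'a list set" where
  "D = {x @ n | x n. x \<in> orbit \<and> n \<in> N}"

lemma D_I: "x \<in> orbit \<Longrightarrow> n \<in> N \<Longrightarrow> x @ n \<in> D"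
  unfolding D_def by blast

lemma definable_D: "definable M A D"
proof -
  obtain n where n: "N \<subseteq> tuples n"
    using definable_dim[OF definable_N] ..
  have "fol_pred M A (\<lambda>e. e 0 \<in> orbit \<and> e 1 \<in> N)"
    unfolding orbit_def
    by (intro fol_pred_conj fol_pred_mem[OF definable_orbit_a] fol_pred_mem[OF definable_N] tuple_term_var)
  from definable_pairs[OF this, of k n] show ?thesis
  proof (rule back_subst[of "definable M A"])
    show "{x @ y | x y. x \<in> tuples k \<and> y \<in> tuples n \<and> x \<in> orbit \<and> y \<in> N} = D"
      unfolding D_def using n orbit_length by (auto simp: tuples_def)
  qed
qed

text \<open>The transition identities say exactly that the gluing relation is an equivalence relation.\<close>

lemma twisted_quotient:
  assumes ei: "eliminates_imaginaries M"
  shows "\<exists>F. definable_map M A D F \<and> (\<forall>x \<in> orbit. \<forall>y \<in> orbit. \<forall>n \<in> N. \<forall>n' \<in> N.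
    F (x @ n) = F (y @ n') \<longleftrightarrow> n \<otimes> transition x y = transition x y \<otimes> n')"
proof -
  define E where "E u v \<longleftrightarrow> (\<exists>f \<in> carrier G. R (take k u) (take k v) f
    \<and> (\<exists>w \<in> carrier G. mult_rel G (drop k u) f w \<and> mult_rel G f (drop k v) w))" for u v
  have E_iff: "E (x @ n) (y @ n') \<longleftrightarrow> n \<otimes> transition x y = transition x y \<otimes> n'"
    if "x \<in> orbit" "y \<in> orbit" "n \<in> N" "n' \<in> N" for x y n n'
    using that by (auto simp: E_def orbit_length R_transition mult_rel_def)
  have E: "fol_pred M A (\<lambda>e. E (e 0) (e 1))"
    unfolding E_def
    by (intro fol_pred_ex_mem[OF definable_carrier] fol_pred_conj fol_pred_subst3[OF R]
        fol_pred_mult tuple_term_take tuple_term_drop tuple_term_var)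
  have "\<exists>F. definable_map M A D F \<and> (\<forall>u \<in> D. \<forall>v \<in> D. E u v \<longleftrightarrow> F u = F v)"
  proof (rule definable_quotient[OF ei definable_D E])
    show "E u u" if "u \<in> D" for u
      using that by (auto simp: D_def E_iff transition_refl)
    show "E v u" if uv: "u \<in> D" "v \<in> D" "E u v" for u v
    proof -
      obtain x n y n' where *: "u = x @ n" "v = y @ n'" "x \<in> orbit" "y \<in> orbit" "n \<in> N" "n' \<in> N"
        using uv by (auto simp: D_def)
      let ?t = "transition x y"
      have c: "?t \<in> carrier G" "n \<in> carrier G" "n' \<in> carrier G"
        using * by simp_all
      have "n \<otimes> ?t = ?t \<otimes> n'"
        using uv(3) * by (simp add: E_iff)
      then have "n' = inv ?t \<otimes> (n \<otimes> ?t)"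
        using c by (simp add: cancel_inv)
      then have "n' \<otimes> inv ?t = inv ?t \<otimes> n"
        using c by (simp add: m_assoc)
      then show ?thesis
        using * by (simp add: E_iff transition_sym[of x y])
    qed
    show "E u w" if uvw: "u \<in> D" "v \<in> D" "w \<in> D" "E u v" "E v w" for u v w
    proof -
      obtain x n y n' z n'' where *: "u = x @ n" "v = y @ n'" "w = z @ n''"
        "x \<in> orbit" "y \<in> orbit" "z \<in> orbit" "n \<in> N" "n' \<in> N" "n'' \<in> N"
        using uvw by (auto simp: D_def)
      let ?t = "transition x y" and ?t' = "transition y z"
      have c: "?t \<in> carrier G" "?t' \<in> carrier G" "n \<in> carrier G" "n' \<in> carrier G" "n'' \<in> carrier G"
        using * by simp_all
      have e: "n \<otimes> ?t = ?t \<otimes> n'" "n' \<otimes> ?t' = ?t' \<otimes> n''"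
        using uvw(4,5) * by (simp_all add: E_iff)
      have "n \<otimes> (?t \<otimes> ?t') = (n \<otimes> ?t) \<otimes> ?t'"
        using c by (simp add: m_assoc)
      also have "\<dots> = ?t \<otimes> (n' \<otimes> ?t')"
        using c e(1) by (simp add: m_assoc)
      also have "\<dots> = ?t \<otimes> ?t' \<otimes> n''"
        using c e(2) by (simp add: m_assoc)
      finally have "n \<otimes> transition x z = transition x z \<otimes> n''"
        using * by (simp add: transition_mult)
      then show ?thesis
        using * by (simp add: E_iff)
    qed
  qed
  then obtain F where F: "definable_map M A D F" "\<And>u v. u \<in> D \<Longrightarrow> v \<in> D \<Longrightarrow> E u v \<longleftrightarrow> F u = F v"
    by blast
  have "F (x @ n) = F (y @ n') \<longleftrightarrow> n \<otimes> transition x y = transition x y \<otimes> n'"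
    if "x \<in> orbit" "y \<in> orbit" "n \<in> N" "n' \<in> N" for x y n n'
    using F(2)[OF D_I D_I, of x n y n'] E_iff[of x y n n'] that by simp
  with F(1) show ?thesis by blast
qed

end

section \<open>The twisted form\<close>

text \<open>\<open>F\<close> is the projection to the glued quotient. It is fixed here so that the group structure
  can be transported along it.\<close>

locale twisted_form = cocycle_twist M A G N \<Phi> a R
  for M :: "('f, 'r, 'a) fo_structure" and A :: "'a set" and G :: "'a list monoid" (structure)
    and N :: "'a list set" and \<Phi> :: "('a \<Rightarrow> 'a) \<Rightarrow> 'a list" and a :: "'a list"
    and R :: "'a list \<Rightarrow> 'a list \<Rightarrow> 'a list \<Rightarrow> bool" +
  fixes F :: "'a list \<Rightarrow> 'a list"
  assumes definable_F: "definable_map M A D F"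
    and F_eq_iff: "\<And>x y n n'. x \<in> orbit \<Longrightarrow> y \<in> orbit \<Longrightarrow> n \<in> N \<Longrightarrow> n' \<in> N \<Longrightarrow>
      F (x @ n) = F (y @ n') \<longleftrightarrow> n \<otimes> transition x y = transition x y \<otimes> n'"
begin

text \<open>Every class has a unique representative over the base point \<open>a\<close>, so \<open>g\<close> identifies \<open>N\<close> with
  the quotient. It needs the parameter \<open>a\<close>, whereas \<open>F\<close> is definable over \<open>A\<close>.\<close>

definition g :: "'a list \<Rightarrow> 'a list" where
  "g n = F (a @ n)"

text \<open>The multiplication is transported along \<open>g\<close>. It turns out not to depend on \<open>a\<close>, because the
  gluing maps are automorphisms of \<open>N\<close> (\<open>F_mult\<close>).\<close>

definition H :: "'a list monoid" where
  "H = \<lparr>carrier = g ` N, mult = \<lambda>u v. g (inv_into N g u \<otimes> inv_into N g v), one = g \<one>\<rparr>"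

lemma g_inj: "inj_on g N"
  using F_eq_iff[OF a_in_orbit a_in_orbit] by (auto simp: inj_on_def g_def transition_refl a_in_orbit)

lemma g_eq_iff: "n \<in> N \<Longrightarrow> n' \<in> N \<Longrightarrow> g n = g n' \<longleftrightarrow> n = n'"
  using g_inj by (simp add: inj_on_eq_iff)

lemma H_simps:
  "carrier H = g ` N" "n \<in> N \<Longrightarrow> n' \<in> N \<Longrightarrow> g n \<otimes>\<^bsub>H\<^esub> g n' = g (n \<otimes> n')" "\<one>\<^bsub>H\<^esub> = g \<one>"
  by (simp_all add: H_def inv_into_f_f[OF g_inj])

lemma group_H: "group H"
proof (rule groupI)
  fix u assume "u \<in> carrier H"
  then obtain n where n: "n \<in> N" "u = g n"
    by (auto simp: H_simps)
  then show "\<exists>v \<in> carrier H. v \<otimes>\<^bsub>H\<^esub> u = \<one>\<^bsub>H\<^esub>"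
    by (intro bexI[of _ "g (inv n)"]) (auto simp: H_simps)
qed (auto simp: H_simps m_assoc)

lemma conj_closed: "c \<in> carrier G \<Longrightarrow> n \<in> N \<Longrightarrow> c \<otimes> n \<otimes> inv c \<in> N"
  by (rule inv_op_closed2)

text \<open>Moving a representative from \<open>x\<close> to the base point costs a conjugation.\<close>

lemma F_transition:
  assumes "x \<in> orbit" "n \<in> N"
  shows "F (x @ n) = g (transition a x \<otimes> n \<otimes> inv (transition a x))"
proof -
  have t: "transition a x \<in> carrier G"
    using assms a_in_orbit by simp
  then show ?thesis
    unfolding g_def using assms a_in_orbit conj_closed[OF t]
    by (subst eq_commute, subst F_eq_iff) (simp_all add: m_assoc)
qed

lemma F_mult:
  assumes "x \<in> orbit" "n \<in> N" "n' \<in> N"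
  shows "F (x @ n) \<otimes>\<^bsub>H\<^esub> F (x @ n') = F (x @ (n \<otimes> n'))"
proof -
  have t: "transition a x \<in> carrier G"
    using assms a_in_orbit by simp
  then have "(transition a x \<otimes> n \<otimes> inv (transition a x)) \<otimes> (transition a x \<otimes> n' \<otimes> inv (transition a x))
      = transition a x \<otimes> (n \<otimes> n') \<otimes> inv (transition a x)"
    using assms by (simp add: m_assoc cancel_inv)
  then show ?thesis
    using assms conj_closed[OF t] by (simp add: F_transition H_simps)
qed

lemma F_image: "F ` D = g ` N"
proof (intro equalityI subsetI)
  fix u assume "u \<in> F ` D"
  then show "u \<in> g ` N"
    using conj_closed a_in_orbit by (auto simp: D_def F_transition)
next
  fix u assume "u \<in> g ` N"
  then show "u \<in> F ` D"
    using a_in_orbit D_I by (auto simp: g_def)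
qed

text \<open>The twist: \<open>\<sigma> (g n)\<close> is the class of \<open>(\<sigma> a, \<sigma> n)\<close>, and returning to \<open>a\<close> conjugates by
  \<open>transition a (\<sigma> a) = \<Phi> \<sigma>\<close>.\<close>

lemma aut_g:
  assumes s: "\<sigma> \<in> aut_over M A" and n: "n \<in> N"
  shows "map \<sigma> (g n) = g (\<Phi> \<sigma> \<otimes> map \<sigma> n \<otimes> inv \<Phi> \<sigma>)"
proof -
  have "map \<sigma> (g n) = F (map \<sigma> a @ map \<sigma> n)"
    using definable_map_aut(2)[OF definable_F D_I[OF a_in_orbit n] s] by (simp add: g_def)
  then show ?thesis
    using F_transition[OF orbitI[OF s] map_in_N[OF s n]] by (simp add: transition_base s)
qed

text \<open>Over \<open>A\<close> the product of two classes is found by choosing representatives over a common, but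
  arbitrary, orbit point; \<open>g\<close> itself could not be used, since it involves \<open>a\<close>.\<close>

lemma definable_group_H: "definable_group M A H"
  unfolding definable_group_def
proof (intro conjI group_H)
  obtain l where l: "g ` N \<subseteq> tuples l"
    using definable_map_dim[OF definable_F] F_image by metis
  have "fol_pred M A (\<lambda>e. \<exists>u \<in> D. graph_rel D F u (e 0))"
    by (intro fol_pred_ex_mem[OF definable_D] fol_pred_graph[OF definable_F] tuple_term_var)
  from definable_fol_pred[OF this, of l] show "definable M A (carrier H)"
  proof (rule back_subst[of "definable M A"])
    show "{x \<in> tuples l. \<exists>u \<in> D. graph_rel D F u x} = carrier H"
      using l by (auto simp: H_simps graph_rel_def F_image[symmetric])
  qed
  \<comment> \<open>\<open>T\<close> is the graph of the multiplication of \<open>H\<close>, described without the base point.\<close>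
  define T where "T u v w \<longleftrightarrow> (\<exists>x \<in> orbit. \<exists>n \<in> N. \<exists>n' \<in> N. \<exists>n'' \<in> N. mult_rel G n n' n''
    \<and> graph_rel D F (x @ n) u \<and> graph_rel D F (x @ n') v \<and> graph_rel D F (x @ n'') w)" for u v w
  have T: "T u v w \<longleftrightarrow> u \<in> g ` N \<and> v \<in> g ` N \<and> w = u \<otimes>\<^bsub>H\<^esub> v" for u v w
  proof
    assume "T u v w"
    then show "u \<in> g ` N \<and> v \<in> g ` N \<and> w = u \<otimes>\<^bsub>H\<^esub> v"
      unfolding T_def using F_image by (auto simp: graph_rel_def mult_rel_def F_mult)
  next
    assume "u \<in> g ` N \<and> v \<in> g ` N \<and> w = u \<otimes>\<^bsub>H\<^esub> v"
    then obtain n n' where n: "n \<in> N" "n' \<in> N" "u = g n" "v = g n'" "w = g (n \<otimes> n')"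
      by (auto simp: H_simps)
    then show "T u v w"
      unfolding T_def using a_in_orbit
      by (intro bexI[of _ a] bexI[of _ n] bexI[of _ n'] bexI[of _ "n \<otimes> n'"])
        (auto simp: mult_rel_def graph_rel_def g_def D_I)
  qed
  have "fol_pred M A (\<lambda>e. T (e 0) (take l (e 1)) (drop l (e 1)))"
    unfolding T_def orbit_def
    by (intro fol_pred_ex_mem[OF definable_orbit_a] fol_pred_ex_mem[OF definable_N] fol_pred_conj
        fol_pred_graph[OF definable_F] fol_pred_mult tuple_term_append tuple_term_take
        tuple_term_drop tuple_term_var)
  from definable_pairs[OF this, of l "l + l"]
  show "definable M A {x @ y @ x \<otimes>\<^bsub>H\<^esub> y | x y. x \<in> carrier H \<and> y \<in> carrier H}"
  proof (rule back_subst[of "definable M A"])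
    have mem: "u \<otimes>\<^bsub>H\<^esub> v \<in> tuples l" if "u \<in> g ` N" "v \<in> g ` N" for u v
      using that l by (auto simp: H_simps)
    show "{x @ y | x y. x \<in> tuples l \<and> y \<in> tuples (l + l) \<and> T x (take l y) (drop l y)}
      = {x @ y @ x \<otimes>\<^bsub>H\<^esub> y | x y. x \<in> carrier H \<and> y \<in> carrier H}" (is "?L = ?R")
    proof (intro equalityI subsetI)
      fix w assume "w \<in> ?L"
      then obtain x y where *: "w = x @ y" "T x (take l y) (drop l y)"
        by blast
      then have "w = x @ take l y @ (x \<otimes>\<^bsub>H\<^esub> take l y)" "x \<in> carrier H" "take l y \<in> carrier H"
        by (metis T append_take_drop_id, simp_all add: T H_simps)
      then show "w \<in> ?R" by blast
    next
      fix w assume "w \<in> ?R"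
      then obtain x y where *: "w = x @ (y @ (x \<otimes>\<^bsub>H\<^esub> y))" "x \<in> g ` N" "y \<in> g ` N"
        by (auto simp: H_simps(1))
      moreover have "length x = l" "length y = l" "length (x \<otimes>\<^bsub>H\<^esub> y) = l"
        using * l mem[of x y] by (auto simp: tuples_def)
      ultimately show "w \<in> ?L"
        by (intro CollectI exI[of _ x] exI[of _ "y @ (x \<otimes>\<^bsub>H\<^esub> y)"]) (auto simp: tuples_def T)
    qed
  qed
qed

lemma g_definable_iso: "g \<in> definable_iso M UNIV (G\<lparr>carrier := N\<rparr>) H"
proof -
  obtain l where l: "g ` N \<subseteq> tuples l"
    using definable_map_dim[OF definable_F] F_image by metis
  have "definable_map M UNIV N g"
  proof (rule definable_map_of_fol_pred[OF _ l])
    show "definable M UNIV N"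
      using definable_N by (rule definable_mono) simp
    show "fol_pred M UNIV (\<lambda>e. graph_rel D F (a @ e 0) (e 1))"
      by (intro fol_pred_graph[OF definable_map_mono[OF definable_F]] tuple_term_append
          tuple_term_const tuple_term_var) simp_all
    show "graph_rel D F (a @ n) y \<longleftrightarrow> y = g n" if "n \<in> N" for n y
      using that by (auto simp: graph_rel_def g_def D_I a_in_orbit)
  qed
  moreover have "g \<in> iso (G\<lparr>carrier := N\<rparr>) H"
    by (auto simp: iso_def hom_def H_simps bij_betw_def g_inj)
  ultimately show ?thesis
    by (simp add: definable_iso_def)
qed

text \<open>With this choice of \<open>g\<close> the two cocycles agree on the nose, not only up to coboundary.\<close>

lemma form_cocycle_g: "form_cocycle M A (G\<lparr>carrier := N\<rparr>) g = conj_cocycle M A G N \<Phi>"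
proof -
  have "compose N (inv_into N g) (act_map N \<sigma> g) = (\<lambda>n \<in> N. \<Phi> \<sigma> \<otimes> n \<otimes> inv \<Phi> \<sigma>)"
    if s: "\<sigma> \<in> aut_over M A" for \<sigma>
  proof
    fix n
    have "inv_into N g (map \<sigma> (g (map (inv_into UNIV \<sigma>) n))) = \<Phi> \<sigma> \<otimes> n \<otimes> inv \<Phi> \<sigma>" if n: "n \<in> N"
      using aut_g[OF s map_in_N[OF aut_inv[OF s] n]] map_aut_inv(1)[OF s, of n]
        conj_closed[OF Z1_def_closed[OF \<Phi> s] n]
      by (simp add: inv_into_f_f[OF g_inj] del: map_map)
    then show "compose N (inv_into N g) (act_map N \<sigma> g) n = (\<lambda>n \<in> N. \<Phi> \<sigma> \<otimes> n \<otimes> inv \<Phi> \<sigma>) n"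
      by (simp add: compose_def act_map_def)
  qed
  then show ?thesis
    by (auto simp: form_cocycle_def conj_cocycle_def intro!: restrict_ext)
qed

section \<open>The conjugation cocycle\<close>

definition conjugation :: "'a list \<Rightarrow> 'a list \<Rightarrow> 'a list" where
  "conjugation c = (\<lambda>n \<in> N. c \<otimes> n \<otimes> inv c)"

lemma conjugation_compose:
  assumes "c \<in> carrier G" "d \<in> carrier G"
  shows "compose N (conjugation c) (conjugation d) = conjugation (c \<otimes> d)"
proof -
  have "c \<otimes> (d \<otimes> n \<otimes> inv d) \<otimes> inv c = c \<otimes> d \<otimes> n \<otimes> inv (c \<otimes> d)" if "n \<in> N" for n
    using assms in_N[OF that] by (simp add: inv_mult_group m_assoc)
  then show ?thesis
    unfolding compose_def conjugation_def
    by (intro restrict_ext) (simp add: conj_closed[OF assms(2)])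
qed

lemma conjugation_one: "conjugation \<one> = (\<lambda>n \<in> N. n)"
  by (auto simp: conjugation_def intro!: restrict_ext)

lemma conjugation_Bij:
  assumes c: "c \<in> carrier G" shows "conjugation c \<in> Bij N"
proof -
  have "bij_betw (conjugation c) N N"
  proof (rule bij_betw_byWitness[where f' = "conjugation (inv c)"])
    show "\<forall>n \<in> N. conjugation (inv c) (conjugation c n) = n"
      "\<forall>n \<in> N. conjugation c (conjugation (inv c) n) = n"
      using c conj_closed[OF c] conj_closed[OF inv_closed[OF c]]
      by (auto simp: conjugation_def m_assoc cancel_inv)
    show "conjugation c ` N \<subseteq> N" "conjugation (inv c) ` N \<subseteq> N"
      using conj_closed[OF c] conj_closed[OF inv_closed[OF c]] by (auto simp: conjugation_def)
  qed
  then show ?thesis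
    by (simp add: Bij_def conjugation_def)
qed

lemma conjugation_Aut_def:
  assumes c: "c \<in> carrier G"
  shows "conjugation c \<in> carrier (Aut_def M (G\<lparr>carrier := N\<rparr>))"
proof -
  have "conjugation c \<in> hom (G\<lparr>carrier := N\<rparr>) (G\<lparr>carrier := N\<rparr>)"
    using c conj_closed[OF c] by (auto simp: hom_def conjugation_def m_assoc cancel_inv)
  moreover obtain l where l: "N \<subseteq> tuples l"
    using definable_dim[OF definable_N] ..
  interpret U: definable_grp M UNIV G
    using definable_group definable_mono[of M A _ UNIV]
    by (unfold_locales) (simp add: definable_group_def)
  have "definable_map M UNIV N (conjugation c)"
  proof (rule definable_map_of_fol_pred)
    show "definable M UNIV N"
      using definable_N by (rule definable_mono) simp
    show "conjugation c ` N \<subseteq> tuples l"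
      using l conj_closed[OF c] by (auto simp: conjugation_def)
    show "fol_pred M UNIV (\<lambda>e. \<exists>w \<in> carrier G. mult_rel G c (e 0) w \<and> mult_rel G (e 1) c w)"
      by (intro fol_pred_ex_mem[OF U.definable_carrier] fol_pred_conj U.fol_pred_mult
          tuple_term_const tuple_term_var) simp_all
    show "(\<exists>w \<in> carrier G. mult_rel G c n w \<and> mult_rel G y c w) \<longleftrightarrow> y = conjugation c n"
      if "n \<in> N" for n y
      using that c conj_closed[OF c that]
      by (simp add: mult_rel_conj conjugation_def)
  qed
  ultimately show ?thesis
    using conjugation_Bij[OF c] by (simp add: Aut_def_def auto_def)
qed

lemma Aut_def_simps:
  "c \<in> carrier G \<Longrightarrow> d \<in> carrier G \<Longrightarrow>
    conjugation c \<otimes>\<^bsub>Aut_def M (G\<lparr>carrier := N\<rparr>)\<^esub> conjugation d = conjugation (c \<otimes> d)"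
  "\<one>\<^bsub>Aut_def M (G\<lparr>carrier := N\<rparr>)\<^esub> = conjugation \<one>"
  by (simp_all add: Aut_def_def AutoGroup_def BijGroup_def conjugation_Bij conjugation_compose
      conjugation_one)

text \<open>Only the inverse of the identity is needed to see that a cocycle is cohomologous to itself,
  so it is computed directly from the uniqueness of inverses.\<close>

lemma Aut_def_inv_one:
  "inv\<^bsub>Aut_def M (G\<lparr>carrier := N\<rparr>)\<^esub> conjugation \<one> = conjugation \<one>"
proof -
  have "f = conjugation \<one>"
    if "f \<in> carrier (Aut_def M (G\<lparr>carrier := N\<rparr>))"
      "conjugation \<one> \<otimes>\<^bsub>Aut_def M (G\<lparr>carrier := N\<rparr>)\<^esub> f = conjugation \<one>" for f
  proof -
    have f: "f \<in> Bij N"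
      using that(1) by (simp add: Aut_def_def auto_def)
    have "compose N (\<lambda>n \<in> N. n) f = (\<lambda>n \<in> N. n)"
      using that(2) f conjugation_Bij[of \<one>]
      by (simp add: Aut_def_def AutoGroup_def BijGroup_def conjugation_one)
    then show ?thesis
      using f by (simp add: Bij_imp_funcset Bij_imp_extensional conjugation_one)
  qed
  then show ?thesis
    unfolding m_inv_def
    by (intro the_equality) (auto simp: conjugation_Aut_def Aut_def_simps)
qed

text \<open>The automorphisms over \<open>A\<close> act on \<open>G\<close> by group automorphisms and preserve \<open>N\<close>.\<close>

lemma act_conjugation:
  assumes s: "\<sigma> \<in> aut_over M A" and c: "c \<in> carrier G"
  shows "act_map N \<sigma> (conjugation c) = conjugation (map \<sigma> c)"
proof -
  have "map \<sigma> (conjugation c (map (inv_into UNIV \<sigma>) n)) = map \<sigma> c \<otimes> n \<otimes> inv (map \<sigma> c)"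
    if n: "n \<in> N" for n
  proof -
    have i: "map (inv_into UNIV \<sigma>) n \<in> N"
      by (rule map_in_N[OF aut_inv[OF s] n])
    then have "map \<sigma> (conjugation c (map (inv_into UNIV \<sigma>) n))
        = map \<sigma> c \<otimes> map \<sigma> (map (inv_into UNIV \<sigma>) n) \<otimes> inv (map \<sigma> c)"
      using s c by (simp add: conjugation_def aut_mult aut_m_inv del: map_map)
    then show ?thesis
      by (simp only: map_aut_inv[OF s])
  qed
  then show ?thesis
    unfolding act_map_def conjugation_def[of "map \<sigma> c"] by (intro restrict_ext)
qed

lemma conj_cocycle_eq: "\<sigma> \<in> aut_over M A \<Longrightarrow> conj_cocycle M A G N \<Phi> \<sigma> = conjugation (\<Phi> \<sigma>)"
  by (simp add: conj_cocycle_def conjugation_def)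

lemma conj_cocycle_Z1: "conj_cocycle M A G N \<Phi> \<in> Z1_Aut_def M A (G\<lparr>carrier := N\<rparr>)"
proof -
  have "conj_cocycle M A G N \<Phi>
      \<in> cocycles (aut_over M A) (Aut_def M (G\<lparr>carrier := N\<rparr>)) (act_map N)"
    unfolding cocycles_def
  proof (intro CollectI conjI ballI)
    show "conj_cocycle M A G N \<Phi> \<in> aut_over M A \<rightarrow>\<^sub>E carrier (Aut_def M (G\<lparr>carrier := N\<rparr>))"
    proof (intro PiE_I)
      show "conj_cocycle M A G N \<Phi> \<sigma> = undefined" if "\<sigma> \<notin> aut_over M A" for \<sigma>
        using that by (simp add: conj_cocycle_def)
    qed (simp add: conj_cocycle_eq conjugation_Aut_def Z1_def_closed[OF \<Phi>])
    fix \<sigma> \<tau> assume s: "\<sigma> \<in> aut_over M A" and t: "\<tau> \<in> aut_over M A"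
    then show "conj_cocycle M A G N \<Phi> (\<sigma> \<circ> \<tau>) = conj_cocycle M A G N \<Phi> \<sigma>
        \<otimes>\<^bsub>Aut_def M (G\<lparr>carrier := N\<rparr>)\<^esub> act_map N \<sigma> (conj_cocycle M A G N \<Phi> \<tau>)"
      by (simp add: conj_cocycle_eq aut_comp act_conjugation Z1_def_closed[OF \<Phi>] Aut_def_simps
          Z1_def_comp[OF \<Phi>])
  qed
  moreover have "\<exists>h. definable_pmap M A h \<and> (\<forall>\<sigma> \<in> aut_over M A. \<forall>n \<in> N.
      h (a @ map \<sigma> a @ n) = Some (conj_cocycle M A G N \<Phi> \<sigma> n))"
  proof -
    obtain l where l: "N \<subseteq> tuples l"
      using definable_dim[OF definable_N] ..
    have "fol_pred M A (\<lambda>e. \<exists>f \<in> carrier G. R (take k (e 0)) (take k (drop k (e 0))) f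
        \<and> (\<exists>w \<in> carrier G. mult_rel G f (drop (k + k) (e 0)) w \<and> mult_rel G (e 1) f w))"
      by (intro fol_pred_ex_mem[OF definable_carrier] fol_pred_conj fol_pred_subst3[OF R]
          fol_pred_mult tuple_term_take tuple_term_drop tuple_term_var)
    from definable_pmap_of_fol_pred[OF this, of "k + k + l" l] obtain h
      where h: "definable_pmap M A h" "\<And>x y. x \<in> tuples (k + k + l) \<Longrightarrow> y \<in> tuples l \<Longrightarrow>
        h x = Some y \<longleftrightarrow> (\<exists>f \<in> carrier G. R (take k x) (take k (drop k x)) f
          \<and> (\<exists>w \<in> carrier G. mult_rel G f (drop (k + k) x) w \<and> mult_rel G y f w))
        \<and> (\<forall>z \<in> tuples l. (\<exists>f \<in> carrier G. R (take k x) (take k (drop k x)) f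
          \<and> (\<exists>w \<in> carrier G. mult_rel G f (drop (k + k) x) w \<and> mult_rel G z f w)) \<longrightarrow> z = y)"
      by blast
    have "h (a @ map \<sigma> a @ n) = Some (conj_cocycle M A G N \<Phi> \<sigma> n)"
      if s: "\<sigma> \<in> aut_over M A" and n: "n \<in> N" for \<sigma> n
    proof -
      have c: "\<Phi> \<sigma> \<in> carrier G"
        by (rule Z1_def_closed[OF \<Phi> s])
      have "a @ map \<sigma> a @ n \<in> tuples (k + k + l)" "conj_cocycle M A G N \<Phi> \<sigma> n \<in> tuples l"
        using n l conj_closed[OF c n] s by (auto simp: tuples_def conj_cocycle_def)
      moreover have "(\<exists>f \<in> carrier G. R a (map \<sigma> a) f
          \<and> (\<exists>w \<in> carrier G. mult_rel G f n w \<and> mult_rel G z f w))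
          \<longleftrightarrow> z = conj_cocycle M A G N \<Phi> \<sigma> n" for z
        using s n c conj_closed[OF c n]
        by (simp add: R_iff mult_rel_conj conj_cocycle_def)
      ultimately show ?thesis
        by (subst h(2)) simp_all
    qed
    with h(1) show ?thesis by blast
  qed
  ultimately show ?thesis
    by (auto simp: Z1_Aut_def_def)
qed

lemma is_twisted_form:
  assumes "\<Phi> \<in> \<mu>"
  shows "is_twisted_form M A G N \<mu> H"
proof -
  have "cohomologous (aut_over M A) (Aut_def M (G\<lparr>carrier := N\<rparr>)) (act_map N)
      (conj_cocycle M A G N \<Phi>) (conj_cocycle M A G N \<Phi>)"
    unfolding cohomologous_def
    by (intro bexI[of _ "conjugation \<one>"])
      (simp_all add: Aut_def_inv_one conj_cocycle_eq act_conjugation Z1_def_closed[OF \<Phi>]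
        Aut_def_simps conjugation_Aut_def)
  then have "(form_cocycle M A (G\<lparr>carrier := N\<rparr>) g, conj_cocycle M A G N \<Phi>)
      \<in> cohom_Aut_rel M A (G\<lparr>carrier := N\<rparr>)"
    by (simp add: form_cocycle_g cohom_Aut_rel_def conj_cocycle_Z1)
  then show ?thesis
    using assms g_definable_iso definable_group_H
    unfolding is_twisted_form_def is_form_def by blast
qed

section \<open>Cocycles of the twisted form\<close>

sublocale H: definable_grp M A H
  by (rule definable_grpI[OF definable_group_H])

text \<open>The factor \<open>\<Phi> \<sigma>\<close> that separates \<open>n \<sigma> = \<Psi> \<sigma> (\<Phi> \<sigma>)\<^sup>-\<^sup>1\<close> from \<open>\<sigma> (n \<tau>)\<close> in the product of
  cocycle values is the one by which \<open>\<sigma>\<close> conjugates in \<open>H\<close> (\<open>aut_g\<close>).\<close>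

lemma twisted_cocycle:
  assumes \<Psi>: "\<Psi> \<in> Z1_def M A G" and N: "\<And>\<sigma>. \<sigma> \<in> aut_over M A \<Longrightarrow> \<Psi> \<sigma> \<otimes> inv \<Phi> \<sigma> \<in> N"
  shows "(\<lambda>\<sigma> \<in> aut_over M A. g (\<Psi> \<sigma> \<otimes> inv \<Phi> \<sigma>)) \<in> Z1_def M A H" (is "?\<theta> \<in> _")
proof -
  obtain a' R' where R': "fol_pred M A (\<lambda>e. R' (e 0) (e 1) (e 2))"
    and eq: "\<And>\<sigma> z. \<sigma> \<in> aut_over M A \<Longrightarrow> R' a' (map \<sigma> a') z \<longleftrightarrow> z = \<Psi> \<sigma>"
    by (rule Z1_defE[OF \<Psi>]) (rule that)
  show ?thesis
  proof (rule H.Z1_defI[where a = "a @ a'"])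
    show "?\<theta> \<in> cocycles (aut_over M A) H map"
      unfolding cocycles_def
    proof (intro CollectI conjI ballI)
      show "?\<theta> \<in> aut_over M A \<rightarrow>\<^sub>E carrier H"
        using N by (auto simp: H_simps)
      fix \<sigma> \<tau> assume s: "\<sigma> \<in> aut_over M A" and t: "\<tau> \<in> aut_over M A"
      note cl = Z1_def_closed[OF \<Phi> s] Z1_def_closed[OF \<Psi> s] Z1_def_closed[OF \<Phi> t]
        Z1_def_closed[OF \<Psi> t] aut_closed[OF s Z1_def_closed[OF \<Phi> t]]
        aut_closed[OF s Z1_def_closed[OF \<Psi> t]]
      let ?n = "\<Phi> \<sigma> \<otimes> map \<sigma> (\<Psi> \<tau> \<otimes> inv \<Phi> \<tau>) \<otimes> inv \<Phi> \<sigma>"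
      have n: "?n \<in> N"
        by (intro conj_closed cl map_in_N s N t)
      have "?\<theta> \<sigma> \<otimes>\<^bsub>H\<^esub> map \<sigma> (?\<theta> \<tau>) = g ((\<Psi> \<sigma> \<otimes> inv \<Phi> \<sigma>) \<otimes> ?n)"
        using s t n N by (simp add: aut_g H_simps)
      also have "(\<Psi> \<sigma> \<otimes> inv \<Phi> \<sigma>) \<otimes> ?n = \<Psi> (\<sigma> \<circ> \<tau>) \<otimes> inv \<Phi> (\<sigma> \<circ> \<tau>)"
        using cl s by (simp add: Z1_def_comp[OF \<Phi> s t] Z1_def_comp[OF \<Psi> s t] aut_mult aut_m_inv
            inv_mult_group m_assoc cancel_inv)
      finally show "?\<theta> (\<sigma> \<circ> \<tau>) = ?\<theta> \<sigma> \<otimes>\<^bsub>H\<^esub> map \<sigma> (?\<theta> \<tau>)"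
        using aut_comp[OF s t] by simp
    qed
    \<comment> \<open>The value is \<open>F (a @ n)\<close> for the solution \<open>n\<close> of \<open>n \<otimes> \<Phi> \<sigma> = \<Psi> \<sigma>\<close>.\<close>
    show "fol_pred M A (\<lambda>e. \<exists>f \<in> carrier G. R (take k (e 0)) (take k (e 1)) f
        \<and> (\<exists>f' \<in> carrier G. R' (drop k (e 0)) (drop k (e 1)) f'
          \<and> (\<exists>n \<in> N. mult_rel G n f f' \<and> graph_rel D F (take k (e 0) @ n) (e 2))))"
      by (intro fol_pred_ex_mem[OF definable_carrier] fol_pred_ex_mem[OF definable_N] fol_pred_conj
          fol_pred_subst3[OF R] fol_pred_subst3[OF R'] fol_pred_graph[OF definable_F]
          fol_pred_mult tuple_term_append tuple_term_take tuple_term_drop tuple_term_var)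
    fix \<sigma> z assume s: "\<sigma> \<in> aut_over M A"
    note cl = Z1_def_closed[OF \<Phi> s] Z1_def_closed[OF \<Psi> s]
    have "n \<otimes> \<Phi> \<sigma> = \<Psi> \<sigma> \<longleftrightarrow> n = \<Psi> \<sigma> \<otimes> inv \<Phi> \<sigma>" if "n \<in> N" for n
      using that cl by (simp add: mult_eq_iff_right)
    then have "(\<exists>n \<in> N. n \<otimes> \<Phi> \<sigma> = \<Psi> \<sigma> \<and> g n = z) \<longleftrightarrow> z = g (\<Psi> \<sigma> \<otimes> inv \<Phi> \<sigma>)"
      using N[OF s] by auto
    then show "(\<exists>f \<in> carrier G. R (take k (a @ a')) (take k (map \<sigma> (a @ a'))) f
        \<and> (\<exists>f' \<in> carrier G. R' (drop k (a @ a')) (drop k (map \<sigma> (a @ a'))) f'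
          \<and> (\<exists>n \<in> N. mult_rel G n f f' \<and> graph_rel D F (take k (a @ a') @ n) z)))
        \<longleftrightarrow> z = ?\<theta> \<sigma>"
      using s cl by (simp add: R_iff eq mult_rel_def graph_rel_def D_I a_in_orbit g_def cong: bex_cong)
  qed
qed

text \<open>A coboundary in \<open>H\<close> is given by some \<open>g m\<close>; pulling it back along \<open>g\<close> and cancelling \<open>\<Phi> \<sigma>\<close>
  shows that \<open>m\<close> is a coboundary between the original cocycles.\<close>

lemma twisted_cocycle_reflects:
  assumes \<Psi>: "\<Psi> \<in> Z1_def M A G" "\<And>\<sigma>. \<sigma> \<in> aut_over M A \<Longrightarrow> \<Psi> \<sigma> \<otimes> inv \<Phi> \<sigma> \<in> N"
    and \<Psi>': "\<Psi>' \<in> Z1_def M A G" "\<And>\<sigma>. \<sigma> \<in> aut_over M A \<Longrightarrow> \<Psi>' \<sigma> \<otimes> inv \<Phi> \<sigma> \<in> N"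
    and rel: "(\<lambda>\<sigma> \<in> aut_over M A. g (\<Psi> \<sigma> \<otimes> inv \<Phi> \<sigma>), \<lambda>\<sigma> \<in> aut_over M A. g (\<Psi>' \<sigma> \<otimes> inv \<Phi> \<sigma>)) \<in> H.H1_rel"
  shows "(\<Psi>, \<Psi>') \<in> H1_rel"
proof -
  obtain c where "c \<in> carrier H"
    and c: "\<And>\<sigma>. \<sigma> \<in> aut_over M A \<Longrightarrow>
      c \<otimes>\<^bsub>H\<^esub> g (\<Psi>' \<sigma> \<otimes> inv \<Phi> \<sigma>) = g (\<Psi> \<sigma> \<otimes> inv \<Phi> \<sigma>) \<otimes>\<^bsub>H\<^esub> map \<sigma> c"
    using rel H.cohomologous_iff[OF twisted_cocycle[OF \<Psi>] twisted_cocycle[OF \<Psi>']] by auto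
  then obtain m where m: "m \<in> N" "c = g m"
    by (auto simp: H_simps)
  have "m \<otimes> \<Psi>' \<sigma> = \<Psi> \<sigma> \<otimes> map \<sigma> m" if s: "\<sigma> \<in> aut_over M A" for \<sigma>
  proof -
    note cl = Z1_def_closed[OF \<Phi> s] Z1_def_closed[OF \<Psi>(1) s] Z1_def_closed[OF \<Psi>'(1) s]
      aut_closed[OF s in_N[OF m(1)]] in_N[OF m(1)]
    have n: "\<Phi> \<sigma> \<otimes> map \<sigma> m \<otimes> inv \<Phi> \<sigma> \<in> N"
      by (intro conj_closed cl map_in_N s m)
    have "g (m \<otimes> (\<Psi>' \<sigma> \<otimes> inv \<Phi> \<sigma>))
        = g ((\<Psi> \<sigma> \<otimes> inv \<Phi> \<sigma>) \<otimes> (\<Phi> \<sigma> \<otimes> map \<sigma> m \<otimes> inv \<Phi> \<sigma>))"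
      using c[OF s] m n s \<Psi>(2)[OF s] \<Psi>'(2)[OF s] by (simp add: aut_g H_simps)
    then have "m \<otimes> (\<Psi>' \<sigma> \<otimes> inv \<Phi> \<sigma>)
        = (\<Psi> \<sigma> \<otimes> inv \<Phi> \<sigma>) \<otimes> (\<Phi> \<sigma> \<otimes> map \<sigma> m \<otimes> inv \<Phi> \<sigma>)"
      using m n s \<Psi>(2)[OF s] \<Psi>'(2)[OF s] by (subst (asm) g_eq_iff) auto
    then have "(m \<otimes> \<Psi>' \<sigma>) \<otimes> inv \<Phi> \<sigma> = (\<Psi> \<sigma> \<otimes> map \<sigma> m) \<otimes> inv \<Phi> \<sigma>"
      using cl by (simp add: m_assoc cancel_inv)
    then show ?thesis
      using cl by simp
  qed
  then have "cohomologous (aut_over M A) G map \<Psi> \<Psi>'"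
    unfolding cohomologous_iff[OF \<Psi>(1) \<Psi>'(1)] using m(1) by (intro bexI[of _ m]) simp_all
  with \<Psi>(1) \<Psi>'(1) show ?thesis by simp
qed

end

section \<open>The map to the quotient and its fibres\<close>

lemma (in definable_grp) Z1_def_image:
  assumes Q: "definable_group M A Q" and p: "p \<in> hom G Q" "definable_map M A (carrier G) p"
    and \<Phi>: "\<Phi> \<in> Z1_def M A G"
  shows "(\<lambda>\<sigma> \<in> aut_over M A. p (\<Phi> \<sigma>)) \<in> Z1_def M A Q"
proof -
  interpret Q: definable_grp M A Q
    by (rule definable_grpI[OF Q])
  obtain a R where R: "fol_pred M A (\<lambda>e. R (e 0) (e 1) (e 2))"
    and eq: "\<And>\<sigma> z. \<sigma> \<in> aut_over M A \<Longrightarrow> R a (map \<sigma> a) z \<longleftrightarrow> z = \<Phi> \<sigma>"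
    by (rule Z1_defE[OF \<Phi>]) (rule that)
  show ?thesis
  proof (rule Q.Z1_defI[where a = a])
    show "(\<lambda>\<sigma> \<in> aut_over M A. p (\<Phi> \<sigma>)) \<in> cocycles (aut_over M A) Q map"
      unfolding cocycles_def
    proof (intro CollectI conjI ballI)
      show "(\<lambda>\<sigma> \<in> aut_over M A. p (\<Phi> \<sigma>)) \<in> aut_over M A \<rightarrow>\<^sub>E carrier Q"
        using hom_in_carrier[OF p(1)] Z1_def_closed[OF \<Phi>] by auto
      fix \<sigma> \<tau> assume s: "\<sigma> \<in> aut_over M A" and t: "\<tau> \<in> aut_over M A"
      then show "(\<lambda>\<sigma> \<in> aut_over M A. p (\<Phi> \<sigma>)) (\<sigma> \<circ> \<tau>)
          = (\<lambda>\<sigma> \<in> aut_over M A. p (\<Phi> \<sigma>)) \<sigma> \<otimes>\<^bsub>Q\<^esub> map \<sigma> ((\<lambda>\<sigma> \<in> aut_over M A. p (\<Phi> \<sigma>)) \<tau>)"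
        by (simp add: aut_comp Z1_def_comp[OF \<Phi>] hom_mult[OF p(1)] Z1_def_closed[OF \<Phi>]
            definable_map_aut(2)[OF p(2)])
    qed
    show "fol_pred M A (\<lambda>e. \<exists>f \<in> carrier G. R (e 0) (e 1) f \<and> graph_rel (carrier G) p f (e 2))"
      by (intro fol_pred_ex_mem[OF definable_carrier] fol_pred_conj fol_pred_subst3[OF R]
          fol_pred_graph[OF p(2)] tuple_term_var)
    show "(\<exists>f \<in> carrier G. R a (map \<sigma> a) f \<and> graph_rel (carrier G) p f z)
        \<longleftrightarrow> z = (\<lambda>\<sigma> \<in> aut_over M A. p (\<Phi> \<sigma>)) \<sigma>" if "\<sigma> \<in> aut_over M A" for \<sigma> z
      using that Z1_def_closed[OF \<Phi> that] by (auto simp: eq graph_rel_def)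
  qed
qed

text \<open>If \<open>q\<close> realizes the coboundary in \<open>Q\<close> and \<open>b\<close> is a lift of \<open>q\<close>, then translating \<open>\<Psi>\<close> by \<open>b\<close>
  translates its image by \<open>q\<close>.\<close>

lemma (in definable_grp) same_image_translate:
  assumes Q: "definable_group M A Q" and p: "p \<in> hom G Q" "definable_map M A (carrier G) p"
    and surj: "p ` carrier G = carrier Q"
    and \<Phi>: "\<Phi> \<in> Z1_def M A G" and \<Psi>: "\<Psi> \<in> Z1_def M A G"
    and coh: "cohomologous (aut_over M A) Q map
      (\<lambda>\<sigma> \<in> aut_over M A. p (\<Psi> \<sigma>)) (\<lambda>\<sigma> \<in> aut_over M A. p (\<Phi> \<sigma>))"
  shows "\<exists>\<Psi>' \<in> Z1_def M A G. (\<Psi>, \<Psi>') \<in> H1_rel \<and> (\<forall>\<sigma> \<in> aut_over M A. p (\<Psi>' \<sigma>) = p (\<Phi> \<sigma>))"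
proof -
  interpret Q: definable_grp M A Q
    by (rule definable_grpI[OF Q])
  interpret p: group_hom G Q p
    using p(1) by unfold_locales
  obtain q where q: "q \<in> carrier Q" "\<And>\<sigma>. \<sigma> \<in> aut_over M A \<Longrightarrow>
      p (\<Phi> \<sigma>) = inv\<^bsub>Q\<^esub> q \<otimes>\<^bsub>Q\<^esub> p (\<Psi> \<sigma>) \<otimes>\<^bsub>Q\<^esub> map \<sigma> q"
    using coh unfolding cohomologous_def by auto
  then obtain b where b: "b \<in> carrier G" "q = p b"
    using surj by blast
  define \<Psi>' where "\<Psi>' = (\<lambda>\<sigma> \<in> aut_over M A. inv b \<otimes> \<Psi> \<sigma> \<otimes> map \<sigma> b)"
  have "p (inv b \<otimes> \<Psi> \<sigma> \<otimes> map \<sigma> b) = p (\<Phi> \<sigma>)" if s: "\<sigma> \<in> aut_over M A" for \<sigma>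
    using b s Z1_def_closed[OF \<Psi> s] by (simp add: q(2) definable_map_aut(2)[OF p(2)])
  then have "\<forall>\<sigma> \<in> aut_over M A. p (\<Psi>' \<sigma>) = p (\<Phi> \<sigma>)"
    by (simp add: \<Psi>'_def)
  moreover note Z1_def_translate[OF \<Psi> b(1), folded \<Psi>'_def]
  ultimately show ?thesis
    by (intro bexI[of _ \<Psi>'] conjI) assumption+
qed

text \<open>Choosing one element of \<open>S\<close> for each value of \<open>f\<close> already meets every class.\<close>

lemma finite_classes_of_invariant:
  assumes r: "equiv Z r" and S: "S \<subseteq> Z" and fin: "finite (f ` S)"
    and inj: "\<And>x y. x \<in> S \<Longrightarrow> y \<in> S \<Longrightarrow> f x = f y \<Longrightarrow> (x, y) \<in> r"
  shows "finite ((\<lambda>x. r `` {x}) ` S)"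
proof -
  have "r `` {x} = r `` {SOME y. y \<in> S \<and> f y = f x}" if "x \<in> S" for x
  proof -
    have "(SOME y. y \<in> S \<and> f y = f x) \<in> S \<and> f (SOME y. y \<in> S \<and> f y = f x) = f x"
      by (rule someI_ex[of "\<lambda>y. y \<in> S \<and> f y = f x"]) (use that in blast)
    then show ?thesis
      by (intro equiv_class_eq[OF r] inj[OF that]) simp_all
  qed
  then have "(\<lambda>x. r `` {x}) ` S \<subseteq> (\<lambda>v. r `` {SOME y. y \<in> S \<and> f y = v}) ` f ` S"
    by blast
  then show ?thesis
    by (rule finite_surj[OF fin])
qed

text \<open>The quotient is covered by finitely many pieces, one for each class \<open>C\<close> downstairs: the
  classes with a representative that \<open>\<pi>\<close> sends into \<open>C\<close>.\<close>

lemma finite_quotient_by_fibres: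
  assumes r: "equiv Z r" and r': "equiv Z' r'" and fin: "finite (Z' // r')"
    and \<pi>: "\<And>x. x \<in> Z \<Longrightarrow> \<pi> x \<in> Z'"
    and fibre: "\<And>x0. x0 \<in> Z \<Longrightarrow> finite ((\<lambda>x. r `` {x}) ` {x \<in> Z. (\<pi> x, \<pi> x0) \<in> r'})"
  shows "finite (Z // r)"
proof -
  have "finite ((\<lambda>x. r `` {x}) ` {x \<in> Z. \<pi> x \<in> C})" if C: "C \<in> Z' // r'" for C
  proof (cases "\<exists>x0 \<in> Z. \<pi> x0 \<in> C")
    case True
    then obtain x0 where x0: "x0 \<in> Z" "\<pi> x0 \<in> C"
      by blast
    have sym: "sym r'"
      using r' by (rule equivE)
    have "{x \<in> Z. \<pi> x \<in> C} = {x \<in> Z. (\<pi> x, \<pi> x0) \<in> r'}"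
      using quotient_eq_iff[OF r' C C _ x0(2)] in_quotient_imp_closed[OF r' C x0(2)] symD[OF sym]
      by blast
    then show ?thesis
      using fibre[OF x0(1)] by simp
  next
    case False
    then have "{x \<in> Z. \<pi> x \<in> C} = {}" by blast
    then show ?thesis by (simp only: image_empty finite.emptyI)
  qed
  then have "finite (\<Union>C \<in> Z' // r'. (\<lambda>x. r `` {x}) ` {x \<in> Z. \<pi> x \<in> C})"
    using fin by blast
  moreover have "Z // r \<subseteq> (\<Union>C \<in> Z' // r'. (\<lambda>x. r `` {x}) ` {x \<in> Z. \<pi> x \<in> C})"
  proof
    fix X assume "X \<in> Z // r"
    then obtain x where x: "x \<in> Z" "X = r `` {x}"
      by (auto elim: quotientE)
    then have "r' `` {\<pi> x} \<in> Z' // r'" "\<pi> x \<in> r' `` {\<pi> x}"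
      using \<pi> equiv_class_self[OF r'] by (auto intro: quotientI)
    with x show "X \<in> (\<Union>C \<in> Z' // r'. (\<lambda>x. r `` {x}) ` {x \<in> Z. \<pi> x \<in> C})"
      by blast
  qed
  ultimately show ?thesis
    by (rule finite_subset[rotated])
qed

lemma exists_twisted_form:
  assumes "atomic_over M A" "homogeneous_over M A" "eliminates_imaginaries M"
    and G: "definable_group M A G" and N: "N \<lhd> G" "definable M A N" and \<Phi>: "\<Phi> \<in> Z1_def M A G"
  shows "\<exists>a R F. twisted_form M A G N \<Phi> a R F"
proof -
  interpret definable_grp M A G
    by (rule definable_grpI[OF G])
  obtain a R where R: "fol_pred M A (\<lambda>e. R (e 0) (e 1) (e 2))"
    "\<And>\<sigma> z. \<sigma> \<in> aut_over M A \<Longrightarrow> R a (map \<sigma> a) z \<longleftrightarrow> z = \<Phi> \<sigma>"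
    by (rule Z1_defE[OF \<Phi>]) (rule that)
  have "cocycle_twist M A G N \<Phi> a R"
    using N \<Phi> R definable_orbit[OF assms(1,2)]
    by (intro cocycle_twist.intro definable_grp_axioms cocycle_twist_axioms.intro)
  then interpret cocycle_twist M A G N \<Phi> a R .
  obtain F where "definable_map M A D F" "\<And>x y n n'. x \<in> orbit \<Longrightarrow> y \<in> orbit \<Longrightarrow> n \<in> N \<Longrightarrow> n' \<in> N \<Longrightarrow>
      F (x @ n) = F (y @ n') \<longleftrightarrow> n \<otimes>\<^bsub>G\<^esub> transition x y = transition x y \<otimes>\<^bsub>G\<^esub> n'"
    using twisted_quotient[OF assms(3)] by blast
  then have "twisted_form M A G N \<Phi> a R F"
    by unfold_locales
  then show ?thesis by blast
qed

theorem corollary4p4: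
  fixes M :: "('f, 'r, 'a) fo_structure" and A :: "'a set"
    and G Q :: "'a list monoid" and N :: "'a list set" and \<iota> :: "'a list set \<Rightarrow> 'a list"
  assumes "atomic_over M A"
    and "homogeneous_over M A"
    and "eliminates_imaginaries M"
    and "definable_group M A G"
    and "N \<lhd> G" and "definable M A N"
    and "quotient_identification M A G N Q \<iota>"
    and "finite (H1_def M A Q)"
    and "\<And>\<mu> H. \<mu> \<in> H1_def M A G \<Longrightarrow> is_twisted_form M A G N \<mu> H \<Longrightarrow> finite (H1_def M A H)"
  shows "finite (H1_def M A G)"
proof -
  interpret G: definable_grp M A G
    by (rule definable_grpI[OF assms(4)])
  interpret normal N G
    by (rule assms(5))
  have Q: "definable_group M A Q" and \<iota>: "\<iota> \<in> iso (G Mod N) Q"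
    and dp: "definable_map M A (carrier G) (\<lambda>g. \<iota> (N #>\<^bsub>G\<^esub> g))"
    using assms(7) by (simp_all add: quotient_identification_def)
  interpret Q: definable_grp M A Q
    by (rule definable_grpI[OF Q])
  define p where "p g = \<iota> (N #>\<^bsub>G\<^esub> g)" for g
  have p: "p \<in> hom G Q" "definable_map M A (carrier G) p"
    using hom_compose[OF r_coset_hom_Mod, of \<iota> Q] \<iota> dp
    by (simp_all add: p_def[abs_def] comp_def iso_def)
  have surj: "p ` carrier G = carrier Q"
    using \<iota> by (auto simp: p_def iso_iff FactGroup_def RCOSETS_def image_iff)
  have ker: "x \<otimes>\<^bsub>G\<^esub> inv\<^bsub>G\<^esub> y \<in> N" if "p x = p y" "x \<in> carrier G" "y \<in> carrier G" for x y
  proof -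
    have "N #>\<^bsub>G\<^esub> x = N #>\<^bsub>G\<^esub> y"
      using that \<iota> by (auto simp: p_def iso_iff FactGroup_def RCOSETS_def dest!: inj_onD)
    then have "x \<in> N #>\<^bsub>G\<^esub> y"
      using G.rcos_self[OF that(2) subgroup_axioms] by simp
    then show ?thesis
      using rcos_module[OF G.is_group that(3,2)] by simp
  qed
  define \<pi> where "\<pi> \<Psi> = (\<lambda>\<sigma> \<in> aut_over M A. p (\<Psi> \<sigma>))" for \<Psi> :: "('a \<Rightarrow> 'a) \<Rightarrow> 'a list"
  have "finite ((\<lambda>\<Psi>. G.H1_rel `` {\<Psi>}) ` {\<Psi> \<in> Z1_def M A G. (\<pi> \<Psi>, \<pi> \<Phi>) \<in> Q.H1_rel})"
    (is "finite (_ ` ?S)") if \<Phi>: "\<Phi> \<in> Z1_def M A G" for \<Phi>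
  proof -
    obtain a R F where "twisted_form M A G N \<Phi> a R F"
      using exists_twisted_form[OF assms(1-6) \<Phi>] by blast
    then interpret twisted_form M A G N \<Phi> a R F .
    have "is_twisted_form M A G N (G.H1_rel `` {\<Phi>}) H"
      using equiv_class_self[OF G.equiv_H1_rel \<Phi>] by (rule is_twisted_form)
    moreover have "G.H1_rel `` {\<Phi>} \<in> H1_def M A G"
      unfolding H1_def_def using \<Phi> by (rule quotientI)
    ultimately have fin: "finite (Z1_def M A H // H.H1_rel)"
      using assms(9) by (simp add: H1_def_def)
    have "\<forall>\<Psi> \<in> ?S. \<exists>\<Psi>'. \<Psi>' \<in> Z1_def M A G \<and> (\<Psi>, \<Psi>') \<in> G.H1_rel
        \<and> (\<forall>\<sigma> \<in> aut_over M A. p (\<Psi>' \<sigma>) = p (\<Phi> \<sigma>))"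
      using G.same_image_translate[OF Q p surj \<Phi>] unfolding \<pi>_def by blast
    from bchoice[OF this] obtain t where "\<forall>\<Psi> \<in> ?S. t \<Psi> \<in> Z1_def M A G \<and> (\<Psi>, t \<Psi>) \<in> G.H1_rel
        \<and> (\<forall>\<sigma> \<in> aut_over M A. p (t \<Psi> \<sigma>) = p (\<Phi> \<sigma>))"
      by (rule exE)
    then have t: "\<And>\<Psi>. \<Psi> \<in> ?S \<Longrightarrow> t \<Psi> \<in> Z1_def M A G" "\<And>\<Psi>. \<Psi> \<in> ?S \<Longrightarrow> (\<Psi>, t \<Psi>) \<in> G.H1_rel"
      "\<And>\<Psi> \<sigma>. \<Psi> \<in> ?S \<Longrightarrow> \<sigma> \<in> aut_over M A \<Longrightarrow> p (t \<Psi> \<sigma>) = p (\<Phi> \<sigma>)"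
      by simp_all
    have tN: "t \<Psi> \<sigma> \<otimes>\<^bsub>G\<^esub> inv\<^bsub>G\<^esub> \<Phi> \<sigma> \<in> N" if "\<Psi> \<in> ?S" "\<sigma> \<in> aut_over M A" for \<Psi> \<sigma>
      using ker t(1)[OF that(1)] t(3)[OF that] \<Phi> that(2) G.Z1_def_closed by blast
    \<comment> \<open>The class of \<open>\<theta> \<Psi>\<close> takes finitely many values and determines the class of \<open>\<Psi>\<close>.\<close>
    define \<theta> where "\<theta> \<Psi> = (\<lambda>\<sigma> \<in> aut_over M A. g (t \<Psi> \<sigma> \<otimes>\<^bsub>G\<^esub> inv\<^bsub>G\<^esub> \<Phi> \<sigma>))" for \<Psi>
    have \<theta>: "\<theta> \<Psi> \<in> Z1_def M A H" if "\<Psi> \<in> ?S" for \<Psi>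
      unfolding \<theta>_def by (rule twisted_cocycle[OF t(1)[OF that] tN[OF that]])
    show ?thesis
    proof (rule finite_classes_of_invariant[OF G.equiv_H1_rel, where f = "\<lambda>\<Psi>. H.H1_rel `` {\<theta> \<Psi>}"])
      have "(\<lambda>\<Psi>. H.H1_rel `` {\<theta> \<Psi>}) ` ?S \<subseteq> Z1_def M A H // H.H1_rel"
        by (intro image_subsetI quotientI \<theta>)
      then show "finite ((\<lambda>\<Psi>. H.H1_rel `` {\<theta> \<Psi>}) ` ?S)"
        using fin by (rule finite_subset)
      fix \<Psi> \<Psi>' assume \<Psi>: "\<Psi> \<in> ?S" and \<Psi>': "\<Psi>' \<in> ?S"
        and eq: "H.H1_rel `` {\<theta> \<Psi>} = H.H1_rel `` {\<theta> \<Psi>'}"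
      have "(\<theta> \<Psi>, \<theta> \<Psi>') \<in> H.H1_rel"
        by (rule eq_equiv_class[OF eq H.equiv_H1_rel \<theta>[OF \<Psi>']])
      note rel = this[unfolded \<theta>_def]
      have "(t \<Psi>, t \<Psi>') \<in> G.H1_rel"
        by (rule twisted_cocycle_reflects[OF t(1)[OF \<Psi>] tN[OF \<Psi>] t(1)[OF \<Psi>'] tN[OF \<Psi>'] rel])
      then have "(\<Psi>, t \<Psi>') \<in> G.H1_rel"
        using t(2)[OF \<Psi>] G.equiv_H1_rel by (meson equivE transE)
      moreover have "(t \<Psi>', \<Psi>') \<in> G.H1_rel"
        using t(2)[OF \<Psi>'] G.equiv_H1_rel by (meson equivE symE)
      ultimately show "(\<Psi>, \<Psi>') \<in> G.H1_rel"
        using G.equiv_H1_rel by (meson equivE transE)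
    qed blast
  qed
  then have "finite (Z1_def M A G // G.H1_rel)"
    using assms(8) G.Z1_def_image[OF Q p]
    by (intro finite_quotient_by_fibres[OF G.equiv_H1_rel Q.equiv_H1_rel, where \<pi> = \<pi>])
      (simp_all add: H1_def_def \<pi>_def)
  then show ?thesis
    by (simp add: H1_def_def)
qed

end
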